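(* Let $(V,G)$ be a finite pseudo reflection group with set of pseudo reflections $R$ and reflection hyperplanes $\{H_i\}_{i\in P}$, let $V_G=\bigoplus_{i\in P}\mathbb{C}v_i$ with the permutation representation $\iota:G\to GL(V_G)$, and let $\{\mu_s\}_{s\in R}$ be constants with $\mu_{s_1}=\mu_{s_2}$ whenever $s_1,s_2$ are conjugate in $G$. Let $\kappa$ be a complex constant. For every $i\in P$ let $p_i\in\mathrm{End}(V_G)$ be a projector to $\mathbb{C}v_i$, written as $p_i(v_i)=m_iv_i$ and $p_i(v_j)=\alpha_{i,j}v_i$ for $j\ne i$. Then the connection $$\Omega_{LK}=\kappa\sum_{i\in P}\Big(\sum_{s\in R:\,v(s)=i}\mu_s\,\iota(s)-p_i\Big)\omega_i$$ on the trivial bundle $M_G\times V_G$ is flat and $G$-invariant if and only if the following conditions are satisfied: (1) $m_i=m_j$ if there is $w\in G$ such that $\iota(w)(v_i)=v_j$; (2) $\alpha_{i,j}=\sum_{s\in R:\,\iota(s)(v_j)=v_i}\mu_s$ for $i\neq j$.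
   Context: A pseudo reflection of a finite dimensional complex vector space $V$ is a non-identity element of $GL(V)$ of finite order fixing pointwise a hyperplane; a finite pseudo reflection group $(V,G)$ is a finite subgroup $G\subset GL(V)$ generated by pseudo reflections. $R$ is the set of pseudo reflections in $G$; $\{H_i\}_{i\in P}$ is the set of their fixed hyperplanes, indexed bijectively by $P$; $v:R\to P$ is defined by $H_{v(s)}=\ker(s-1)$. $G$ acts on $P$ by $w(H_i)=H_{w(i)}$, and $\iota(w)(v_i)=v_{w(i)}$. Here "projector to $\mathbb{C}v_i$" is used for a linear map of the displayed form (not necessarily idempotent). $M_G=V\setminus\bigcup_{i\in P}H_i$; for each $i$, $f_i$ is a nonzero linear form with kernel $H_i$ and $\omega_i=d\log f_i$. A connection $\Omega=\sum_iX_i\omega_i$ on the trivial bundle (flat sections: $d\Phi=\Omega\Phi$) is flat if $d\Omega-\Omega\wedge\Omega=0$; it is $G$-invariant if it is invariant under the diagonal action $w\cdot(x,u)=(wx,\iota(w)u)$ of $G$, i.e. $X_{w(i)}=\iota(w)X_i\iota(w)^{-1}$ for all $w\in G$, $i\in P$.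
   Formalization: The "only if" direction additionally assumes that κ is nonzero and that every p_i is nonzero, since it is false otherwise (e.g. κ = 0, or all p_i = 0 for S_3 with μ = 1); the "if" direction is proved without these assumptions. *)

theory Defs
  imports "HOL-Analysis.Analysis" "HOL-Algebra.Generated_Groups"
begin

text \<open>Throughout, V is \<open>complex ^ 'n\<close> and GL(V) consists of the invertible matrices, acting by \<open>*v\<close>.
  Complex-linear notions on V are the \<open>vec\<close>-qualified ones (scalar multiplication \<open>*s\<close>).\<close>

definition GL :: "(complex ^ 'n ^ 'n) monoid" where
  "GL = \<lparr>carrier = {A. invertible A}, mult = (**), one = mat 1\<rparr>"

definition hyperplane :: "(complex ^ 'n) set \<Rightarrow> bool" where
  "hyperplane H \<longleftrightarrow> vec.subspace H \<and> vec.dim H + 1 = CARD('n)"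

definition pseudo_reflection :: "complex ^ 'n ^ 'n \<Rightarrow> bool" where
  "pseudo_reflection s \<longleftrightarrow>
     s \<in> carrier GL \<and> s \<noteq> mat 1 \<and>
     (\<exists>k::nat. k > 0 \<and> s [^]\<^bsub>GL\<^esub> k = mat 1) \<and>
     (\<exists>H. hyperplane H \<and> (\<forall>x\<in>H. s *v x = x))"

definition pseudo_reflections :: "(complex ^ 'n ^ 'n) set \<Rightarrow> (complex ^ 'n ^ 'n) set" where
  "pseudo_reflections G = {s \<in> G. pseudo_reflection s}"

definition finite_pseudo_reflection_group :: "(complex ^ 'n ^ 'n) set \<Rightarrow> bool" where
  "finite_pseudo_reflection_group G \<longleftrightarrow>
     subgroup G GL \<and> finite G \<and> generate GL (pseudo_reflections G) = G"

definition conjugate_in :: "(complex ^ 'n ^ 'n) set \<Rightarrow> complex ^ 'n ^ 'n \<Rightarrow> complex ^ 'n ^ 'n \<Rightarrow> bool" where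
  "conjugate_in G s t \<longleftrightarrow> (\<exists>g\<in>G. t = g ** s ** matrix_inv g)"

definition fixed_hyperplane :: "complex ^ 'n ^ 'n \<Rightarrow> (complex ^ 'n) set" where
  "fixed_hyperplane s = {x. (s - mat 1) *v x = 0}"

text \<open>The reflection hyperplanes are \<open>H i\<close> for \<open>i \<in> P\<close>. The index set is a subset of a finite
  type rather than a whole type so that it may be empty (\<open>G\<close> trivial).\<close>

definition indexes_hyperplanes ::
  "(complex ^ 'n ^ 'n) set \<Rightarrow> 'p set \<Rightarrow> ('p \<Rightarrow> (complex ^ 'n) set) \<Rightarrow> bool" where
  "indexes_hyperplanes G P H \<longleftrightarrow> bij_betw H P (fixed_hyperplane ` pseudo_reflections G)"

definition refl_index :: "'p set \<Rightarrow> ('p \<Rightarrow> (complex ^ 'n) set) \<Rightarrow> complex ^ 'n ^ 'n \<Rightarrow> 'p" where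
  "refl_index P H s = (THE i. i \<in> P \<and> H i = fixed_hyperplane s)"

definition index_action ::
  "'p set \<Rightarrow> ('p \<Rightarrow> (complex ^ 'n) set) \<Rightarrow> complex ^ 'n ^ 'n \<Rightarrow> 'p \<Rightarrow> 'p" where
  "index_action P H w i = (THE j. j \<in> P \<and> H j = (\<lambda>x. w *v x) ` H i)"

definition hyperplane_complement :: "'p set \<Rightarrow> ('p \<Rightarrow> (complex ^ 'n) set) \<Rightarrow> (complex ^ 'n) set" where
  "hyperplane_complement P H = - (\<Union>i\<in>P. H i)"

text \<open>\<open>V\<^sub>G\<close> is the span of the \<open>bvec i\<close>, \<open>i \<in> P\<close>, inside \<open>complex ^ 'p\<close>; its endomorphisms are the
  matrices supported on \<open>P \<times> P\<close>. In particular the identity of \<open>V\<^sub>G\<close> is \<open>perm_rep P H (mat 1)\<close>.\<close>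

definition bvec :: "'p \<Rightarrow> complex ^ 'p" where
  "bvec i = axis i 1"

definition End_VG :: "'p set \<Rightarrow> (complex ^ 'p ^ 'p) set" where
  "End_VG P = {A. \<forall>a b. a \<notin> P \<or> b \<notin> P \<longrightarrow> A $ a $ b = 0}"

definition perm_rep ::
  "'p set \<Rightarrow> ('p \<Rightarrow> (complex ^ 'n) set) \<Rightarrow> complex ^ 'n ^ 'n \<Rightarrow> complex ^ 'p ^ 'p" where
  "perm_rep P H w = (\<chi> a b. if a \<in> P \<and> b \<in> P \<and> a = index_action P H w b then 1 else 0)"

text \<open>Scalar multiplication of matrices (on matrices, \<open>*s\<close> would act row by row with a vector).\<close>

definition cscale :: "complex \<Rightarrow> complex ^ 'a ^ 'b \<Rightarrow> complex ^ 'a ^ 'b" (infixr "*m" 75) where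
  "c *m A = (\<chi> a b. c * A $ a $ b)"

text \<open>A matrix-valued 1-form \<open>\<Omega>\<close> is given by its value \<open>\<Omega> x y\<close> at the point \<open>x\<close> on the tangent
  vector \<open>y\<close>, a 2-form by its value on two tangent vectors; no factor 1/2 is used in either the
  exterior derivative or the wedge product. The forms used are holomorphic on an open
  set, so that real Frechet derivatives are the complex ones.\<close>

definition dlog :: "(complex ^ 'n \<Rightarrow> complex) \<Rightarrow> complex ^ 'n \<Rightarrow> complex ^ 'n \<Rightarrow> complex" where
  "dlog f x y = frechet_derivative f (at x) y / f x"

definition ext_deriv ::
  "(complex ^ 'n \<Rightarrow> complex ^ 'n \<Rightarrow> complex ^ 'p ^ 'p) \<Rightarrow>
   complex ^ 'n \<Rightarrow> complex ^ 'n \<Rightarrow> complex ^ 'n \<Rightarrow> complex ^ 'p ^ 'p" where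
  "ext_deriv \<Omega> x y z =
     frechet_derivative (\<lambda>u. \<Omega> u z) (at x) y - frechet_derivative (\<lambda>u. \<Omega> u y) (at x) z"

definition wedge ::
  "(complex ^ 'n \<Rightarrow> complex ^ 'n \<Rightarrow> complex ^ 'p ^ 'p) \<Rightarrow>
   (complex ^ 'n \<Rightarrow> complex ^ 'n \<Rightarrow> complex ^ 'p ^ 'p) \<Rightarrow>
   complex ^ 'n \<Rightarrow> complex ^ 'n \<Rightarrow> complex ^ 'n \<Rightarrow> complex ^ 'p ^ 'p" where
  "wedge \<Omega> \<Psi> x y z = \<Omega> x y ** \<Psi> x z - \<Omega> x z ** \<Psi> x y"

definition flat_connection_on ::
  "(complex ^ 'n) set \<Rightarrow> (complex ^ 'n \<Rightarrow> complex ^ 'n \<Rightarrow> complex ^ 'p ^ 'p) \<Rightarrow> bool" where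
  "flat_connection_on M \<Omega> \<longleftrightarrow>
     (\<forall>x\<in>M. \<forall>y z. ext_deriv \<Omega> x y z - wedge \<Omega> \<Omega> x y z = 0)"

text \<open>Invariance of the connection \<open>d - \<Omega>\<close> under \<open>w \<cdot> (x, u) = (w x, \<rho>(w) u)\<close>: this action sends
  flat sections to flat sections. The inverse of \<open>\<rho> w\<close> in \<open>GL(V\<^sub>G)\<close> is written as the image
  of the inverse of \<open>w\<close>, since \<open>\<rho> w\<close> need not be invertible as a matrix on all of \<open>complex ^ 'p\<close>.\<close>

definition invariant_connection_on ::
  "(complex ^ 'n ^ 'n) set \<Rightarrow> (complex ^ 'n ^ 'n \<Rightarrow> complex ^ 'p ^ 'p) \<Rightarrow> (complex ^ 'n) set \<Rightarrow>
   (complex ^ 'n \<Rightarrow> complex ^ 'n \<Rightarrow> complex ^ 'p ^ 'p) \<Rightarrow> bool" where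
  "invariant_connection_on G \<rho> M \<Omega> \<longleftrightarrow>
     (\<forall>w\<in>G. \<forall>x\<in>M. \<forall>y. \<Omega> (w *v x) (w *v y) = \<rho> w ** \<Omega> x y ** \<rho> (matrix_inv w))"

definition LK_connection ::
  "(complex ^ 'n ^ 'n) set \<Rightarrow> 'p set \<Rightarrow> ('p \<Rightarrow> (complex ^ 'n) set) \<Rightarrow> ('p \<Rightarrow> complex ^ 'n \<Rightarrow> complex) \<Rightarrow>
   complex \<Rightarrow> (complex ^ 'n ^ 'n \<Rightarrow> complex) \<Rightarrow> ('p \<Rightarrow> complex ^ 'p ^ 'p) \<Rightarrow>
   complex ^ 'n \<Rightarrow> complex ^ 'n \<Rightarrow> complex ^ 'p ^ 'p" where
  "LK_connection G P H f \<kappa> \<mu> p x y =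
     \<kappa> *m (\<Sum>i\<in>P. dlog (f i) x y *m
       ((\<Sum>s | s \<in> pseudo_reflections G \<and> refl_index P H s = i. \<mu> s *m perm_rep P H s) - p i))"

end

theory Submission
  imports Defs
begin

text \<open>A connection with simple poles along an arrangement is flat iff in each pencil, i.e. each set
  of all hyperplanes through a common codimension two subspace, every residue commutes with the sum
  of the residues of the pencil, and it is \<open>G\<close>-invariant iff its residues are permuted by \<open>G\<close>.
  Write the residue at \<open>H\<^sub>i\<close> as \<open>\<kappa> (T\<^sub>i - p\<^sub>i)\<close>. The group part \<open>T\<^sub>i\<close> is always equivariant, and for
  an invariant connection it commutes with the sum \<open>B\<close> of a pencil containing \<open>i\<close>; so flatness says
  that \<open>p\<^sub>i\<close> commutes with \<open>B\<close>. If \<open>p\<^sub>i \<noteq> 0\<close>, this makes \<open>v\<^sub>i\<close>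
  an eigenvector of \<open>B\<close>, and its vanishing components are condition (2), because a
  reflection moving \<open>H\<^sub>i\<close> to \<open>H\<^sub>k \<noteq> H\<^sub>i\<close> has its hyperplane in the pencil of \<open>H\<^sub>i\<close> and \<open>H\<^sub>k\<close>.
  Conversely, condition (2) makes \<open>v\<^sub>i\<close> an eigenvector of \<open>B\<close>, and equivariance of the coefficients of
  the \<open>p\<^sub>i\<close> makes the row vector of \<open>p\<^sub>i\<close> a left eigenvector with the same eigenvalue.\<close>

section \<open>Complex matrices\<close>

lemma cscale_nth [simp]: "(c *m A) $ a $ b = c * A $ a $ b"
  by (simp add: cscale_def)

lemma cscale_mult_left: "(c *m A) ** B = c *m (A ** B)"
  by (simp add: vec_eq_iff matrix_matrix_mult_def sum_distrib_left mult.assoc)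

lemma cscale_mult_right: "A ** (c *m B) = c *m (A ** B)"
  by (simp add: vec_eq_iff matrix_matrix_mult_def sum_distrib_left mult.left_commute)

lemma cscale_diff_right: "c *m (A - B) = c *m A - c *m B"
  by (simp add: vec_eq_iff algebra_simps)

lemma cscale_cscale: "c *m d *m A = (c * d) *m A"
  by (simp add: vec_eq_iff algebra_simps)

lemma cscale_sum_right: "c *m (\<Sum>i\<in>S. A i) = (\<Sum>i\<in>S. c *m A i)"
  by (simp add: vec_eq_iff sum_distrib_left)

lemma matrix_add_rdistrib:
  fixes A :: "'a::semiring_1 ^ 'm ^ 'n"
  shows "(A + B) ** C = A ** C + B ** C"
  by (simp add: vec_eq_iff matrix_matrix_mult_def distrib_right sum.distrib)

lemma matrix_diff_ldistrib:
  fixes A :: "'a::ring_1 ^ 'm ^ 'n"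
  shows "A ** (B - C) = A ** B - A ** C"
  by (simp add: vec_eq_iff matrix_matrix_mult_def right_diff_distrib sum_subtractf)

lemma matrix_diff_rdistrib:
  fixes A :: "'a::ring_1 ^ 'm ^ 'n"
  shows "(A - B) ** C = A ** C - B ** C"
  by (simp add: vec_eq_iff matrix_matrix_mult_def left_diff_distrib sum_subtractf)

lemma matrix_sum_ldistrib:
  fixes A :: "'a::semiring_1 ^ 'm ^ 'n"
  shows "A ** (\<Sum>i\<in>S. B i) = (\<Sum>i\<in>S. A ** B i)"
  by (induct S rule: infinite_finite_induct)
    (simp_all add: vec_eq_iff matrix_matrix_mult_def distrib_left sum.distrib)

lemma matrix_sum_rdistrib:
  fixes A :: "'i \<Rightarrow> 'a::semiring_1 ^ 'm ^ 'n"
  shows "(\<Sum>i\<in>S. A i) ** B = (\<Sum>i\<in>S. A i ** B)"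
  by (induct S rule: infinite_finite_induct)
    (simp_all add: vec_eq_iff matrix_matrix_mult_def distrib_right sum.distrib)

section \<open>Commutators of square matrices\<close>

definition commutator :: "complex ^ 'a ^ 'a \<Rightarrow> complex ^ 'a ^ 'a \<Rightarrow> complex ^ 'a ^ 'a" where
  "commutator A B = A ** B - B ** A"

lemma commutator_self [simp]: "commutator A A = 0"
  by (simp add: commutator_def)

lemma commutator_swap: "commutator B A = - commutator A B"
  by (simp add: commutator_def)

lemma commutator_cscale_left: "commutator (c *m A) B = c *m commutator A B"
  by (simp add: commutator_def cscale_mult_left cscale_mult_right cscale_diff_right)

lemma commutator_cscale_right: "commutator A (c *m B) = c *m commutator A B"
  by (simp add: commutator_def cscale_mult_left cscale_mult_right cscale_diff_right)

lemma commutator_add_left: "commutator (A + B) C = commutator A C + commutator B C"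
  by (simp add: commutator_def matrix_add_ldistrib matrix_add_rdistrib)

lemma commutator_add_right: "commutator A (B + C) = commutator A B + commutator A C"
  by (simp add: commutator_def matrix_add_ldistrib matrix_add_rdistrib)

lemma commutator_sum_left: "commutator (\<Sum>i\<in>S. A i) B = (\<Sum>i\<in>S. commutator (A i) B)"
  by (simp add: commutator_def matrix_sum_ldistrib matrix_sum_rdistrib sum_subtractf)

lemma commutator_sum_right: "commutator A (\<Sum>i\<in>S. B i) = (\<Sum>i\<in>S. commutator A (B i))"
  by (simp add: commutator_def matrix_sum_ldistrib matrix_sum_rdistrib sum_subtractf)

lemma commutator_bilinear_sum:
  "commutator (\<Sum>i\<in>S. a i *m X i) (\<Sum>j\<in>T. b j *m Y j) =
     (\<Sum>(i, j)\<in>S \<times> T. (a i * b j) *m commutator (X i) (Y j))"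
  by (simp only: commutator_sum_left) (simp add: commutator_sum_right commutator_cscale_left
      commutator_cscale_right cscale_cscale cscale_sum_right sum.cartesian_product
      mult.commute)

section \<open>Linear forms\<close>

abbreviation linear_form :: "(complex ^ 'n \<Rightarrow> complex) \<Rightarrow> bool" where
  "linear_form f \<equiv> Vector_Spaces.linear (*s) (*) f"

lemma linear_form_add: "linear_form f \<Longrightarrow> f (x + y) = f x + f y"
  by (rule module_hom.add[OF Vector_Spaces.linear.axioms(3)])

lemma linear_form_scale: "linear_form f \<Longrightarrow> f (c *s x) = c * f x"
  by (rule module_hom.scale[OF Vector_Spaces.linear.axioms(3)])

lemma linear_form_zero: "linear_form f \<Longrightarrow> f 0 = 0"
  using linear_form_scale[of f 0 0] by simp

lemma linear_form_diff: "linear_form f \<Longrightarrow> f (x - y) = f x - f y"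
  using linear_form_add[of f "x - y" y] by simp

lemmas linear_form_simps =
  linear_form_add linear_form_scale linear_form_zero linear_form_diff

text \<open>Frechet derivatives are taken over the reals, so complex homogeneity is first
  specialised to real scalars; boundedness is automatic in finite dimension.\<close>

lemma linear_form_has_derivative:
  assumes "linear_form f"
  shows "(f has_derivative f) (at x)"
proof -
  have "linear f"
  proof (rule linearI)
    show "f (x + y) = f x + f y" for x y
      by (rule linear_form_add[OF assms])
    show "f (r *\<^sub>R x) = r *\<^sub>R f x" for r x
    proof -
      have "r *\<^sub>R x = complex_of_real r *s x"
        by (simp add: vec_eq_iff) (simp add: scaleR_conv_of_real)
      then show ?thesis
        by (simp add: linear_form_scale[OF assms] scaleR_conv_of_real)
    qed
  qed
  then show ?thesis
    by (simp add: bounded_linear_imp_has_derivative linear_conv_bounded_linear)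
qed

lemma dlog_linear_form: "linear_form f \<Longrightarrow> dlog f x y = f y / f x"
  by (simp add: dlog_def frechet_derivative_at[OF linear_form_has_derivative, symmetric])

text \<open>Subtracting the multiple of \<open>e\<close> with the same \<open>f\<close>-value moves
  \<open>x\<close> into the kernel of \<open>f\<close>, where \<open>g\<close> vanishes.\<close>

lemma linear_form_proportional:
  assumes f: "linear_form f" and g: "linear_form g"
    and e: "f e \<noteq> 0" and ker: "\<And>x. f x = 0 \<Longrightarrow> g x = 0"
  shows "g x = g e / f e * f x"
proof -
  have "f (x - (f x / f e) *s e) = 0"
    using e by (simp add: linear_form_simps[OF f])
  from ker[OF this] show ?thesis
    by (simp add: linear_form_simps[OF g])
qed

text \<open>Up to scaling \<open>u\<close> and \<open>v\<close> are dual to \<open>f\<close> and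
  \<open>g\<close>, so removing the two components of \<open>x\<close> leaves a common zero of
  \<open>f\<close> and \<open>g\<close>.\<close>

lemma linear_form_in_span_of_two:
  assumes f: "linear_form f" and g: "linear_form g" and h: "linear_form h"
    and u: "g u = 0" "f u \<noteq> 0" and v: "f v = 0" "g v \<noteq> 0"
    and ker: "\<And>x. f x = 0 \<Longrightarrow> g x = 0 \<Longrightarrow> h x = 0"
  shows "h x = h u / f u * f x + h v / g v * g x"
proof -
  let ?y = "x - (f x / f u) *s u - (g x / g v) *s v"
  have "f ?y = 0" "g ?y = 0"
    using u v by (simp_all add: linear_form_simps[OF f] linear_form_simps[OF g])
  from ker[OF this] show ?thesis
    by (simp add: linear_form_simps[OF h] algebra_simps)
qed

text \<open>A complex vector space is not a finite union of proper subspaces. This supplies the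
  generic points of a hyperplane or of a codimension two intersection at which residues are
  taken.\<close>

lemma exists_common_nonzero:
  fixes f :: "'i \<Rightarrow> complex ^ 'n \<Rightarrow> complex"
  assumes "finite I" and W: "vec.subspace W"
    and "\<And>i. i \<in> I \<Longrightarrow> linear_form (f i)"
    and "\<And>i. i \<in> I \<Longrightarrow> \<exists>x\<in>W. f i x \<noteq> 0"
  shows "\<exists>x\<in>W. \<forall>i\<in>I. f i x \<noteq> 0"
  using assms(1,3,4)
proof (induction I)
  case empty
  then show ?case
    using W vec.subspace_0 by blast
next
  case (insert k I)
  then obtain x where x: "x \<in> W" "\<forall>i\<in>I. f i x \<noteq> 0"
    by auto
  obtain y where y: "y \<in> W" "f k y \<noteq> 0"
    using insert.prems(2)[of k] by auto
  \<comment> \<open>On the line \<open>x + t *s y\<close> each form is affine in \<open>t\<close>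
    and not identically zero, hence has at most one zero. If \<open>f i y = 0\<close> there is none,
    and the quotient on the right is just 0.\<close>
  have bad: "finite {t. f i x + t * f i y = 0}" if "i \<in> insert k I" for i
  proof (rule finite_subset)
    have "f i x \<noteq> 0 \<or> f i y \<noteq> 0"
      using that x y by auto
    then show "{t. f i x + t * f i y = 0} \<subseteq> {- f i x / f i y}"
      by (auto simp: field_simps add_eq_0_iff2)
  qed simp
  have "finite (\<Union>i\<in>insert k I. {t. f i x + t * f i y = 0})"
    using bad insert.hyps by blast
  then obtain t where t: "t \<notin> (\<Union>i\<in>insert k I. {t. f i x + t * f i y = 0})"
    using ex_new_if_finite infinite_UNIV_char_0 by blast
  have "x + t *s y \<in> W"
    by (simp add: W x y vec.subspace_add vec.subspace_scale)
  moreover have "f i (x + t *s y) \<noteq> 0" if "i \<in> insert k I" for i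
    using t that by (auto simp: linear_form_simps[OF insert.prems(1)[OF that]])
  ultimately show ?case
    by blast
qed

section \<open>Limits of matrix-valued functions\<close>

lemma tendsto_matrix_mult:
  fixes A :: "'b \<Rightarrow> complex ^ 'm ^ 'n" and B :: "'b \<Rightarrow> complex ^ 'k ^ 'm"
  assumes "(A \<longlongrightarrow> a) F" "(B \<longlongrightarrow> b) F"
  shows "((\<lambda>t. A t ** B t) \<longlongrightarrow> a ** b) F"
  unfolding matrix_matrix_mult_def
  by (intro tendsto_vec_lambda tendsto_sum tendsto_mult tendsto_vec_nth assms)

lemma tendsto_commutator:
  assumes "(A \<longlongrightarrow> a) F" "(B \<longlongrightarrow> b) F"
  shows "((\<lambda>t. commutator (A t) (B t)) \<longlongrightarrow> commutator a b) F"
  unfolding commutator_def by (intro tendsto_diff tendsto_matrix_mult assms)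

lemma tendsto_at_eventually_eq:
  fixes g :: "'b::perfect_space \<Rightarrow> 'c::t2_space"
  assumes "(g \<longlongrightarrow> a) (at x)" "\<forall>\<^sub>F t in at x. g t = c"
  shows "a = c"
  by (rule tendsto_unique[OF at_neq_bot assms(1) tendsto_eventually[OF assms(2)]])

lemma bounded_linear_cscale_left: "bounded_linear (\<lambda>c. c *m A)"
  by (simp add: linear_conv_bounded_linear[symmetric] linear_iff vec_eq_iff distrib_right)

section \<open>Logarithmic connections on the complement of an arrangement\<close>

locale arrangement =
  fixes P :: "'p set" and f :: "'p \<Rightarrow> complex ^ 'n \<Rightarrow> complex"
  assumes finite_P: "finite P"
    and lin: "i \<in> P \<Longrightarrow> linear_form (f i)"
    and nonzero: "i \<in> P \<Longrightarrow> \<exists>x. f i x \<noteq> 0"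
    and not_proportional: "i \<in> P \<Longrightarrow> j \<in> P \<Longrightarrow> i \<noteq> j \<Longrightarrow> \<exists>x. f i x = 0 \<and> f j x \<noteq> 0"
begin

definition regular :: "(complex ^ 'n) set" where
  "regular = {x. \<forall>i\<in>P. f i x \<noteq> 0}"

text \<open>The index set is a parameter because limits at points of the arrangement are forms of
  the same kind over a subset of \<open>P\<close>.\<close>

definition log_form ::
  "'p set \<Rightarrow> ('p \<Rightarrow> complex ^ 'q ^ 'q) \<Rightarrow> complex ^ 'n \<Rightarrow> complex ^ 'n \<Rightarrow> complex ^ 'q ^ 'q" where
  "log_form S X x y = (\<Sum>i\<in>S. (f i y / f i x) *m X i)"

text \<open>For distinct \<open>i\<close> and \<open>k\<close> in \<open>P\<close> the two kernels
  meet in codimension two; stating containment pointwise on this intersection avoids any dimension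
  count.\<close>

definition pencil :: "'p \<Rightarrow> 'p \<Rightarrow> 'p set" where
  "pencil i k = {j \<in> P. \<forall>x. f i x = 0 \<longrightarrow> f k x = 0 \<longrightarrow> f j x = 0}"

lemma subspace_kernel: "i \<in> P \<Longrightarrow> vec.subspace {x. f i x = 0}"
  by (auto simp: vec.subspace_def linear_form_simps[OF lin])

lemma log_form_add:
  "S \<subseteq> P \<Longrightarrow> log_form S X x (y + z) = log_form S X x y + log_form S X x z"
  by (auto simp: log_form_def linear_form_add[OF lin] vec_eq_iff sum.distrib[symmetric]
      add_divide_distrib distrib_right intro!: sum.cong)

lemma log_form_scale: "S \<subseteq> P \<Longrightarrow> log_form S X x (c *s y) = c *m log_form S X x y"
  by (auto simp: log_form_def linear_form_scale[OF lin] cscale_sum_right cscale_cscale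
      intro!: sum.cong)

lemma log_form_diff:
  "S \<subseteq> P \<Longrightarrow> log_form S X x (y - z) = log_form S X x y - log_form S X x z"
  using log_form_add[of S X x "y - z" z] by simp

text \<open>Evaluation on the Euler vector field makes each \<open>f i x / f i x\<close> equal to 1.
  The sum of the residues thereby becomes a value of the form.\<close>

lemma log_form_Euler:
  assumes "S \<subseteq> P" "x \<in> regular"
  shows "log_form S X x x = (\<Sum>i\<in>S. X i)"
  using assms by (auto simp: log_form_def regular_def vec_eq_iff intro!: sum.cong)

section \<open>Residues at points of the arrangement\<close>

lemma eventually_regular:
  assumes "\<And>i. i \<in> P \<Longrightarrow> f i l = 0 \<Longrightarrow> f i u \<noteq> 0"
  shows "\<forall>\<^sub>F t in at 0. l + t *s u \<in> regular"
proof -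
  have "\<forall>\<^sub>F t in at 0. f i (l + t *s u) \<noteq> 0" if i: "i \<in> P" for i
  proof (cases "f i l = 0")
    case True
    have "\<forall>\<^sub>F t::complex in at 0. t \<noteq> 0"
      by (simp add: eventually_at_filter)
    then show ?thesis
      by eventually_elim (use True assms[OF i] in \<open>simp add: linear_form_simps[OF lin[OF i]]\<close>)
  next
    case False
    have "((\<lambda>t. f i l + t * f i u) \<longlongrightarrow> f i l + 0 * f i u) (at 0)"
      by (intro tendsto_intros)
    then have "\<forall>\<^sub>F t in at 0. f i l + t * f i u \<noteq> 0"
      using False tendsto_imp_eventually_ne by fastforce
    then show ?thesis
      by (simp add: linear_form_simps[OF lin[OF i]])
  qed
  then show ?thesis
    by (simp add: regular_def eventually_ball_finite[OF finite_P])
qed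

text \<open>On the line \<open>l + t *s u\<close> a form vanishing at \<open>l\<close> takes the
  value \<open>t * f i u\<close>, so the factor \<open>t\<close> cancels its pole. The other terms
  stay bounded and are killed by \<open>t\<close>.\<close>

lemma log_form_residue:
  assumes u: "\<And>i. i \<in> P \<Longrightarrow> f i l = 0 \<Longrightarrow> f i u \<noteq> 0"
  shows "((\<lambda>t. t *m log_form P X (l + t *s u) y) \<longlongrightarrow> log_form {i \<in> P. f i l = 0} X u y) (at 0)"
proof -
  have lim: "((\<lambda>t. t * (f i y / f i (l + t *s u))) \<longlongrightarrow> (if f i l = 0 then f i y / f i u else 0)) (at 0)"
    if i: "i \<in> P" for i
  proof (cases "f i l = 0")
    case True
    have "\<forall>\<^sub>F t::complex in at 0. t \<noteq> 0"
      by (simp add: eventually_at_filter)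
    then have "\<forall>\<^sub>F t in at 0. f i y / f i u = t * (f i y / f i (l + t *s u))"
      by eventually_elim (use True u[OF i] in \<open>simp add: linear_form_simps[OF lin[OF i]]\<close>)
    then show ?thesis
      using True by (simp add: tendsto_eventually eventually_mono)
  next
    case False
    have "((\<lambda>t. t * (f i y / (f i l + t * f i u))) \<longlongrightarrow> 0 * (f i y / (f i l + 0 * f i u))) (at 0)"
      by (intro tendsto_intros) (use False in simp)
    then show ?thesis
      using False by (simp add: linear_form_simps[OF lin[OF i]])
  qed
  have "((\<lambda>t. (\<Sum>i\<in>P. t * (f i y / f i (l + t *s u)) * X i $ a $ b)) \<longlongrightarrow>
      (\<Sum>i\<in>P. (if f i l = 0 then f i y / f i u else 0) * X i $ a $ b)) (at 0)" for a b
    by (intro tendsto_sum tendsto_mult lim tendsto_const)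
  moreover have "(\<Sum>i\<in>P. (if f i l = 0 then f i y / f i u else 0) * X i $ a $ b) =
      (\<Sum>i | i \<in> P \<and> f i l = 0. f i y / f i u * X i $ a $ b)" for a b
    by (intro sum.mono_neutral_cong_right) (auto simp: finite_P)
  ultimately show ?thesis
    by (intro vec_tendstoI)
      (simp add: log_form_def sum_distrib_left mult.assoc)
qed

text \<open>At a point \<open>l\<close> lying on the kernel of \<open>f i\<close> and on no other
  kernel, the limit in \<open>log_form_residue\<close> isolates \<open>X i\<close>; so a logarithmic
  form determines its residues.\<close>

lemma log_form_eq_0_imp:
  assumes zero: "\<And>x y. x \<in> regular \<Longrightarrow> log_form P X x y = 0" and i: "i \<in> P"
  shows "X i = 0"
proof -
  have "\<exists>x\<in>{x. f i x = 0}. \<forall>j\<in>P - {i}. f j x \<noteq> 0"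
    by (rule exists_common_nonzero)
      (use i finite_P lin not_proportional in \<open>auto simp: subspace_kernel\<close>)
  then obtain l where l: "f i l = 0" "\<And>j. j \<in> P \<Longrightarrow> j \<noteq> i \<Longrightarrow> f j l \<noteq> 0"
    by auto
  obtain u where u: "f i u \<noteq> 0"
    using nonzero[OF i] by auto
  have u': "f j u \<noteq> 0" if "j \<in> P" "f j l = 0" for j
    using l u that by metis
  have eq: "{j \<in> P. f j l = 0} = {i}"
    using l i by auto
  have "log_form {j \<in> P. f j l = 0} X u u = X i"
    unfolding eq using u by (simp add: log_form_def vec_eq_iff)
  then have "((\<lambda>t. t *m log_form P X (l + t *s u) u) \<longlongrightarrow> X i) (at 0)"
    using log_form_residue[where l = l and u = u and X = X and y = u] u' by simp
  moreover have "\<forall>\<^sub>F t in at 0. t *m log_form P X (l + t *s u) u = 0"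
    using eventually_regular[where l = l and u = u] u'
    by (auto elim!: eventually_mono simp: zero vec_eq_iff)
  ultimately show ?thesis
    by (rule tendsto_at_eventually_eq)
qed

section \<open>Pencils of hyperplanes and integrability\<close>

lemma pencil_subset: "pencil i k \<subseteq> P"
  by (auto simp: pencil_def)

lemma pencil_members: "i \<in> P \<Longrightarrow> k \<in> P \<Longrightarrow> i \<in> pencil i k \<and> k \<in> pencil i k"
  by (auto simp: pencil_def)

text \<open>All forms of a pencil are combinations of \<open>f a\<close> and \<open>f b\<close>. Two
  non-proportional ones are another basis of this plane of forms and so have the same common
  kernel.\<close>

lemma pencil_eq:
  assumes ab: "a \<in> P" "b \<in> P" "a \<noteq> b" and ij: "i \<in> pencil a b" "j \<in> pencil a b" "i \<noteq> j"
  shows "pencil i j = pencil a b"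
proof -
  obtain u where u: "f b u = 0" "f a u \<noteq> 0"
    using not_proportional ab by metis
  obtain v where v: "f a v = 0" "f b v \<noteq> 0"
    using not_proportional ab by metis
  have P: "i \<in> P" "j \<in> P"
    using ij pencil_subset by auto
  have span: "\<exists>c d. \<forall>x. f k x = c * f a x + d * f b x" if "k \<in> pencil a b" for k
  proof -
    have "k \<in> P" and "\<And>x. f a x = 0 \<Longrightarrow> f b x = 0 \<Longrightarrow> f k x = 0"
      using that by (auto simp: pencil_def)
    then show ?thesis
      using linear_form_in_span_of_two[OF lin[OF ab(1)] lin[OF ab(2)] lin u v] by metis
  qed
  obtain c d where i: "\<And>x. f i x = c * f a x + d * f b x"
    using span[OF ij(1)] by metis
  obtain c' d' where j: "\<And>x. f j x = c' * f a x + d' * f b x"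
    using span[OF ij(2)] by metis
  obtain w where w: "f i w = 0" "f j w \<noteq> 0"
    using not_proportional P ij by metis
  \<comment> \<open>A zero determinant, evaluated at the point \<open>w\<close> that separates
    \<open>f i\<close> from \<open>f j\<close>, would force \<open>c = d = 0\<close> and hence
    \<open>f i = 0\<close>.\<close>
  have det: "c * d' - d * c' \<noteq> 0"
  proof
    assume 0: "c * d' - d * c' = 0"
    have "c * f j w = (c * d' - d * c') * f b w + c' * f i w"
      by (simp add: i j algebra_simps)
    also have "\<dots> = 0"
      unfolding 0 w by simp
    finally have "c = 0"
      using w by simp
    have "d * f j w = d' * f i w - (c * d' - d * c') * f a w"
      by (simp add: i j algebra_simps)
    also have "\<dots> = 0"
      unfolding 0 w by simp
    finally have "d = 0"
      using w by simp
    then show False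
      using nonzero[OF P(1)] i \<open>c = 0\<close> by simp
  qed
  have "f a x = 0 \<and> f b x = 0" if "f i x = 0" "f j x = 0" for x
  proof -
    have "(c * d' - d * c') * f a x = d' * f i x - d * f j x"
      "(c * d' - d * c') * f b x = c * f j x - c' * f i x"
      by (simp_all add: i j algebra_simps)
    then show ?thesis
      using that det by simp
  qed
  moreover have "f i x = 0 \<and> f j x = 0" if "f a x = 0" "f b x = 0" for x
    using that by (simp add: i j)
  ultimately show ?thesis
    unfolding pencil_def by blast
qed

text \<open>The forms of a pencil span a two-dimensional space, so three vectors are dependent modulo
  the common kernel. The value of the restricted form at the point \<open>x\<close> itself is the sum of all
  residues, which is central; hence the alternating form below has a kernel and vanishes.\<close>

lemma commutator_log_form_pencil:
  assumes ab: "a \<in> P" "b \<in> P" and x: "x \<in> regular"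
    and central: "\<And>i. i \<in> pencil a b \<Longrightarrow> commutator (X i) (\<Sum>j\<in>pencil a b. X j) = 0"
  shows "commutator (log_form (pencil a b) X x y) (log_form (pencil a b) X x z) = 0"
proof -
  let ?S = "pencil a b"
  let ?L = "log_form ?S X x"
  have sub: "?S \<subseteq> P"
    by (rule pencil_subset)
  have zero: "?L v = 0" if "f a v = 0" "f b v = 0" for v
    using that by (simp add: log_form_def pencil_def vec_eq_iff)
  have "commutator (?L w) (?L x) = 0" for w
  proof -
    have "commutator (?L w) (\<Sum>j\<in>?S. X j) = (\<Sum>i\<in>?S. (f i w / f i x) *m commutator (X i) (\<Sum>j\<in>?S. X j))"
      by (simp only: log_form_def commutator_sum_left commutator_cscale_left)
    also have "\<dots> = 0"
      by (simp add: central vec_eq_iff)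
    finally show ?thesis
      by (simp add: log_form_Euler[OF sub x])
  qed
  then have Lx: "commutator (?L w) (?L x) = 0" "commutator (?L x) (?L w) = 0" for w
    using commutator_swap[of "?L x" "?L w"] by simp_all
  \<comment> \<open>\<open>D\<close> is the determinant in the coordinates \<open>f a\<close>,
    \<open>f b\<close> on the quotient by the common kernel.\<close>
  define D where "D v w = f a v * f b w - f b v * f a w" for v w
  have cancel: "A = 0" if "c *m A = 0" "c \<noteq> 0" for c and A :: "complex ^ 'b ^ 'b"
    using that by (simp add: vec_eq_iff)
  show ?thesis
  proof (cases "D x y = 0")
    case True
    \<comment> \<open>Since \<open>f a x\<close> is nonzero, vanishing of \<open>D x y\<close> makes
      \<open>y\<close> a multiple of \<open>x\<close> modulo the common kernel.\<close>
    have "?L (f a x *s y - f a y *s x) = 0"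
      using True by (intro zero) (simp_all add: linear_form_simps[OF lin] ab D_def algebra_simps)
    then have "f a x *m ?L y = f a y *m ?L x"
      by (simp add: log_form_diff[OF sub] log_form_scale[OF sub])
    then have "f a x *m commutator (?L y) (?L z) = f a y *m commutator (?L x) (?L z)"
      by (metis commutator_cscale_left)
    then have "f a x *m commutator (?L y) (?L z) = 0"
      by (simp add: Lx vec_eq_iff)
    then show ?thesis
      using x ab by (auto simp: regular_def intro: cancel)
  next
    case False
    \<comment> \<open>Cramer's relation between three vectors of a plane: the combination lies in
      the common kernel.\<close>
    have "?L (D y z *s x + D z x *s y + D x y *s z) = 0"
      by (intro zero) (simp_all add: linear_form_simps[OF lin] ab D_def algebra_simps)
    then have "D y z *m ?L x + D z x *m ?L y + D x y *m ?L z = 0"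
      by (simp add: log_form_add[OF sub] log_form_scale[OF sub])
    then have "commutator (?L y) (D y z *m ?L x + D z x *m ?L y + D x y *m ?L z) = 0"
      by (simp add: commutator_def)
    then have "D y z *m commutator (?L y) (?L x) + D x y *m commutator (?L y) (?L z) + D z x *m commutator (?L y) (?L y) = 0"
      by (simp add: commutator_add_right commutator_cscale_right algebra_simps)
    then have "D x y *m commutator (?L y) (?L z) = 0"
      by (simp add: Lx vec_eq_iff)
    then show ?thesis
      using False by (rule cancel)
  qed
qed

text \<open>The diagonal terms of the bilinear expansion vanish, and each ordered pair of distinct
  indices belongs to exactly one pencil, so the remaining terms can be grouped by pencils.\<close>

lemma commutator_log_form_eq_sum_pencils:
  "commutator (log_form P X x y) (log_form P X x z) =
     (\<Sum>S\<in>{pencil i k |i k. i \<in> P \<and> k \<in> P \<and> i \<noteq> k}.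
        commutator (log_form S X x y) (log_form S X x z))"
proof -
  let ?T = "{pencil i k |i k. i \<in> P \<and> k \<in> P \<and> i \<noteq> k}"
  define c where "c = (\<lambda>(i, j). (f i y / f i x * (f j z / f j x)) *m commutator (X i) (X j))"
  define off where "off S = {(i, j). i \<in> S \<and> j \<in> S \<and> i \<noteq> j}" for S :: "'p set"
  have bilinear: "commutator (log_form S X x y) (log_form S X x z) = sum c (off S)" if "S \<subseteq> P" for S
  proof -
    have "finite S"
      using that finite_P finite_subset by auto
    then have "sum c (S \<times> S) = sum c (off S)"
      by (intro sum.mono_neutral_right) (auto simp: off_def c_def vec_eq_iff)
    then show ?thesis
      unfolding log_form_def commutator_bilinear_sum c_def .
  qed
  have fin: "finite (off P)"
    by (rule finite_subset[of _ "P \<times> P"]) (auto simp: off_def finite_P)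
  have im: "(\<lambda>(i, j). pencil i j) ` off P = ?T"
    by (auto simp: off_def image_iff)
  have fibre: "{q \<in> off P. (case q of (i, j) \<Rightarrow> pencil i j) = S} = off S" if "S \<in> ?T" for S
  proof -
    obtain a b where ab: "a \<in> P" "b \<in> P" "a \<noteq> b" and S: "S = pencil a b"
      using \<open>S \<in> ?T\<close> by blast
    have "i \<in> P \<and> j \<in> P \<and> pencil i j = S \<longleftrightarrow> i \<in> S \<and> j \<in> S" if "i \<noteq> j" for i j
      using pencil_eq[OF ab _ _ that] pencil_members[of i j] pencil_subset[of a b]
      unfolding S by blast
    then show ?thesis
      by (auto simp: off_def)
  qed
  have "finite ?T"
    unfolding im[symmetric] by (rule finite_imageI[OF fin])
  then have "sum c (off P) = (\<Sum>S\<in>?T. sum c {q \<in> off P. (case q of (i, j) \<Rightarrow> pencil i j) = S})"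
    by (intro sum.group[symmetric] fin) (simp_all only: im order_refl)
  also have "\<dots> = (\<Sum>S\<in>?T. sum c (off S))"
    by (simp only: fibre cong: sum.cong)
  also have "\<dots> = (\<Sum>S\<in>?T. commutator (log_form S X x y) (log_form S X x z))"
    using bilinear pencil_subset by (intro sum.cong) auto
  finally show ?thesis
    by (simp add: bilinear)
qed

text \<open>Given integrability, the double pole at a generic point of a codimension two
  intersection yields the same identity for one pencil; evaluating on the Euler field and taking
  residues isolates each commutator. Conversely, the commutator splits into contributions of
  pencils, and each of them vanishes.\<close>

proposition integrable_iff_pencils_commute:
  "(\<forall>x\<in>regular. \<forall>y z. commutator (log_form P X x y) (log_form P X x z) = 0) \<longleftrightarrow>
   (\<forall>i\<in>P. \<forall>k\<in>P. i \<noteq> k \<longrightarrow> commutator (X i) (\<Sum>j\<in>pencil i k. X j) = 0)"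
proof (intro iffI ballI allI impI)
  fix i k
  assume flat: "\<forall>x\<in>regular. \<forall>y z. commutator (log_form P X x y) (log_form P X x z) = 0"
    and ik: "i \<in> P" "k \<in> P" "i \<noteq> k"
  let ?S = "pencil i k"
  \<comment> \<open>A generic point of the codimension two intersection lies on no hyperplane
    outside the pencil.\<close>
  have "\<exists>l\<in>{x. f i x = 0} \<inter> {x. f k x = 0}. \<forall>j\<in>P - ?S. f j l \<noteq> 0"
    by (rule exists_common_nonzero)
      (use ik finite_P lin in \<open>auto simp: subspace_kernel vec.subspace_inter pencil_def\<close>)
  then obtain l where l: "f i l = 0" "f k l = 0" "\<And>j. j \<in> P \<Longrightarrow> j \<notin> ?S \<Longrightarrow> f j l \<noteq> 0"
    by auto
  then have S: "{j \<in> P. f j l = 0} = ?S"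
    by (auto simp: pencil_def)
  \<comment> \<open>Extended by zero outside the pencil so that \<open>log_form_eq_0_imp\<close>,
    which concerns forms over all of \<open>P\<close>, applies.\<close>
  let ?Y = "\<lambda>j. if j \<in> ?S then commutator (X j) (\<Sum>j\<in>?S. X j) else 0"
  have "log_form P ?Y u y = 0" if u: "u \<in> regular" for u y
  proof -
    have u': "f j u \<noteq> 0" if "j \<in> P" for j
      using u that by (simp add: regular_def)
    have lim: "((\<lambda>t. t *m log_form P X (l + t *s u) w) \<longlongrightarrow> log_form ?S X u w) (at 0)" for w
      unfolding S[symmetric] using u' by (intro log_form_residue)
    \<comment> \<open>The second tangent vector is \<open>u\<close> itself, so the limit contains
      the Euler value, the sum of the residues of the pencil.\<close>
    have "((\<lambda>t. commutator (t *m log_form P X (l + t *s u) y) (t *m log_form P X (l + t *s u) u)) \<longlongrightarrow>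
        commutator (log_form ?S X u y) (log_form ?S X u u)) (at 0)"
      by (intro tendsto_commutator lim)
    moreover have "\<forall>\<^sub>F t in at 0. commutator (t *m log_form P X (l + t *s u) y) (t *m log_form P X (l + t *s u) u) = 0"
      using eventually_regular[where l = l and u = u] u' flat
      by (auto elim!: eventually_mono simp: commutator_cscale_left commutator_cscale_right vec_eq_iff)
    ultimately have "commutator (log_form ?S X u y) (log_form ?S X u u) = 0"
      by (rule tendsto_at_eventually_eq)
    moreover have "log_form P ?Y u y = log_form ?S ?Y u y"
      unfolding log_form_def
      by (intro sum.mono_neutral_right) (auto simp: finite_P pencil_def vec_eq_iff)
    moreover have "log_form ?S ?Y u y = commutator (log_form ?S X u y) (\<Sum>j\<in>?S. X j)"
      by (simp add: log_form_def commutator_sum_left commutator_cscale_left)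
    ultimately show ?thesis
      by (simp add: log_form_Euler[OF pencil_subset u])
  qed
  then have "?Y i = 0"
    using ik(1) by (rule log_form_eq_0_imp)
  then show "commutator (X i) (\<Sum>j\<in>?S. X j) = 0"
    using pencil_members[OF ik(1,2)] by simp
next
  fix x y z
  assume comm: "\<forall>i\<in>P. \<forall>k\<in>P. i \<noteq> k \<longrightarrow> commutator (X i) (\<Sum>j\<in>pencil i k. X j) = 0"
    and x: "x \<in> regular"
  have "commutator (log_form (pencil a b) X x y) (log_form (pencil a b) X x z) = 0"
    if ab: "a \<in> P" "b \<in> P" "a \<noteq> b" for a b
  proof (rule commutator_log_form_pencil[OF ab(1,2) x])
    fix i assume i: "i \<in> pencil a b"
    obtain k where k: "k \<in> pencil a b" "k \<noteq> i"
      using pencil_members[OF ab(1,2)] ab(3) by metis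
    then have "pencil i k = pencil a b"
      using pencil_eq[OF ab i] by metis
    then show "commutator (X i) (\<Sum>j\<in>pencil a b. X j) = 0"
      using comm i k pencil_subset by (metis subsetD)
  qed
  then show "commutator (log_form P X x y) (log_form P X x z) = 0"
    unfolding commutator_log_form_eq_sum_pencils by (intro sum.neutral) auto
qed

text \<open>Each logarithmic derivative is closed: the derivative of \<open>f i w / f i u\<close>
  with respect to \<open>u\<close> in direction \<open>v\<close> is symmetric in \<open>v\<close>
  and \<open>w\<close>.\<close>

lemma ext_deriv_log_form:
  assumes x: "x \<in> regular"
  shows "ext_deriv (log_form P X) x y z = 0"
proof -
  have deriv: "frechet_derivative (\<lambda>u. log_form P X u w) (at x) v =
      (\<Sum>i\<in>P. (- (f i w * f i v / (f i x * f i x))) *m X i)" for v w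
  proof -
    have "((\<lambda>u. log_form P X u w) has_derivative
        (\<lambda>v. \<Sum>i\<in>P. (- (f i w * f i v / (f i x * f i x))) *m X i)) (at x)"
      unfolding log_form_def
    proof (intro has_derivative_sum bounded_linear.has_derivative[OF bounded_linear_cscale_left])
      fix i assume i: "i \<in> P"
      then have "f i x \<noteq> 0"
        using x by (simp add: regular_def)
      from has_derivative_divide[OF has_derivative_const linear_form_has_derivative[OF lin[OF i]] this, of "f i w"]
      show "((\<lambda>u. f i w / f i u) has_derivative (\<lambda>v. - (f i w * f i v / (f i x * f i x)))) (at x)"
        by (simp add: field_simps)
    qed
    then show ?thesis
      by (simp add: frechet_derivative_at[symmetric])
  qed
  show ?thesis
    by (simp add: ext_deriv_def deriv mult.commute)
qed

lemma flat_log_form_iff: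
  "flat_connection_on regular (log_form P X) \<longleftrightarrow>
   (\<forall>i\<in>P. \<forall>k\<in>P. i \<noteq> k \<longrightarrow> commutator (X i) (\<Sum>j\<in>pencil i k. X j) = 0)"
  unfolding flat_connection_on_def integrable_iff_pencils_commute[symmetric]
  by (simp add: ext_deriv_log_form wedge_def commutator_def) metis

end

section \<open>The reflection arrangement of a finite reflection group\<close>

lemma matrix_inv_invertible:
  fixes A :: "'a::semiring_1 ^ 'n ^ 'n"
  assumes "invertible A"
  shows "A ** matrix_inv A = mat 1" "matrix_inv A ** A = mat 1"
proof -
  have "A ** matrix_inv A = mat 1 \<and> matrix_inv A ** A = mat 1"
    unfolding matrix_inv_def by (rule someI_ex) (use assms in \<open>simp add: invertible_def\<close>)
  then show "A ** matrix_inv A = mat 1" "matrix_inv A ** A = mat 1"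
    by auto
qed

lemma GL_simps [simp]:
  "carrier GL = {A. invertible A}" "x \<otimes>\<^bsub>GL\<^esub> y = x ** y" "\<one>\<^bsub>GL\<^esub> = mat 1"
  by (simp_all add: GL_def)

lemma invertible_mat_1: "invertible (mat 1 :: complex ^ 'n ^ 'n)"
  unfolding invertible_def by (rule exI[of _ "mat 1"]) simp

lemma group_GL: "group GL"
proof (rule groupI)
  fix x :: "complex ^ 'n ^ 'n"
  assume "x \<in> carrier GL"
  then have "matrix_inv x \<in> carrier GL \<and> matrix_inv x \<otimes>\<^bsub>GL\<^esub> x = \<one>\<^bsub>GL\<^esub>"
    using matrix_inv_invertible[of x] by (auto simp: invertible_def)
  then show "\<exists>y\<in>carrier GL. y \<otimes>\<^bsub>GL\<^esub> x = \<one>\<^bsub>GL\<^esub>"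
    by blast
qed (auto simp: invertible_mult invertible_mat_1 matrix_mul_assoc)

lemma GL_inv: "invertible x \<Longrightarrow> inv\<^bsub>GL\<^esub> x = matrix_inv x"
  using group.inv_equality[OF group_GL, of "matrix_inv x" x] matrix_inv_invertible[of x]
  by (auto simp: invertible_def)

lemma GL_pow_conj:
  fixes w s :: "complex ^ 'n ^ 'n"
  assumes w: "invertible w" and s: "invertible s"
  shows "(w ** s ** matrix_inv w) [^]\<^bsub>GL\<^esub> (k::nat) = w ** (s [^]\<^bsub>GL\<^esub> k) ** matrix_inv w"
proof (induction k)
  interpret group GL by (rule group_GL)
  {
    case 0
    then show ?case
      by (simp add: matrix_inv_invertible[OF w])
  next
    case (Suc k)
    have "w ** (s [^]\<^bsub>GL\<^esub> k) ** matrix_inv w ** (w ** s ** matrix_inv w) =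
      w ** (s [^]\<^bsub>GL\<^esub> k) ** (matrix_inv w ** w) ** s ** matrix_inv w"
      by (simp only: matrix_mul_assoc)
    then show ?case
      by (simp add: Suc matrix_inv_invertible[OF w] matrix_mul_assoc)
  }
qed

lemma hyperplane_image:
  fixes w :: "complex ^ 'n ^ 'n"
  assumes "invertible w" "hyperplane S"
  shows "hyperplane ((*v) w ` S)"
proof -
  have "inj ((*v) w)"
    by (rule inj_matrix_vector_mult[OF assms(1)])
  then have "vec.dim ((*v) w ` S) = vec.dim S"
    by (intro vec.dim_image_eq) (auto simp: inj_on_def)
  then show ?thesis
    using assms(2) by (simp add: hyperplane_def vec.subspace_image)
qed

lemma mem_fixed_hyperplane: "x \<in> fixed_hyperplane s \<longleftrightarrow> s *v x = x"
  by (simp add: fixed_hyperplane_def matrix_vector_mult_diff_rdistrib)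

lemma fixed_hyperplane_conj:
  fixes w s :: "complex ^ 'n ^ 'n"
  assumes "invertible w"
  shows "fixed_hyperplane (w ** s ** matrix_inv w) = (*v) w ` fixed_hyperplane s"
proof -
  have 1: "matrix_inv w *v (w *v x) = x" and 2: "w *v (matrix_inv w *v x) = x" for x
    by (simp_all add: matrix_vector_mul_assoc matrix_inv_invertible[OF assms])
  have "w *v (s *v (matrix_inv w *v x)) = x \<longleftrightarrow> (\<exists>y. s *v y = y \<and> x = w *v y)" for x
    by (metis 1 2)
  then show ?thesis
    by (auto simp: mem_fixed_hyperplane matrix_vector_mul_assoc[symmetric])
qed

lemma bvec_inject [simp]: "bvec i = bvec j \<longleftrightarrow> i = j"
  by (simp add: bvec_def axis_eq_axis)

lemma matrix_bvec: "(A *v bvec j) $ a = A $ a $ j"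
  by (simp add: bvec_def axis_def matrix_vector_mult_def if_distrib cong: if_cong)

section \<open>The action of the group on its reflection hyperplanes\<close>

locale reflection_arrangement =
  fixes G :: "(complex ^ 'n ^ 'n) set"
    and P :: "'p::finite set"
    and H :: "'p \<Rightarrow> (complex ^ 'n) set"
    and f :: "'p \<Rightarrow> complex ^ 'n \<Rightarrow> complex"
  assumes reflection_group: "finite_pseudo_reflection_group G"
    and indexes: "indexes_hyperplanes G P H"
    and form: "i \<in> P \<Longrightarrow> linear_form (f i)"
    and form_nonzero: "i \<in> P \<Longrightarrow> f i \<noteq> (\<lambda>_. 0)"
    and form_kernel: "i \<in> P \<Longrightarrow> {x. f i x = 0} = H i"
begin

abbreviation "R \<equiv> pseudo_reflections G"
abbreviation "act \<equiv> index_action P H"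
abbreviation "idx \<equiv> refl_index P H"
abbreviation "rep \<equiv> perm_rep P H"

lemma subgroup_G: "subgroup G GL" and finite_G: "finite G"
  using reflection_group by (auto simp: finite_pseudo_reflection_group_def)

lemma G_invertible: "w \<in> G \<Longrightarrow> invertible w"
  using subgroup.subset[OF subgroup_G] by auto

lemma G_mult: "u \<in> G \<Longrightarrow> w \<in> G \<Longrightarrow> u ** w \<in> G"
  using subgroup.m_closed[OF subgroup_G] by simp

lemma G_inv: "w \<in> G \<Longrightarrow> matrix_inv w \<in> G"
  using subgroup.m_inv_closed[OF subgroup_G, of w] by (simp add: GL_inv G_invertible)

lemmas G_matrix_inv = matrix_inv_invertible[OF G_invertible]

lemma R_subset: "R \<subseteq> G"
  by (auto simp: pseudo_reflections_def)

lemma finite_R: "finite R"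
  by (rule finite_subset[OF R_subset finite_G])

lemma R_in_G: "s \<in> R \<Longrightarrow> s \<in> G"
  using R_subset by auto

text \<open>Conjugation preserves finite order and being different from the identity, and
  \<open>w\<close> carries the fixed hyperplane along. This is what lets \<open>G\<close> permute
  the reflection hyperplanes.\<close>

lemma R_conj:
  assumes s: "s \<in> R" and w: "w \<in> G"
  shows "w ** s ** matrix_inv w \<in> R"
proof -
  have sG: "s \<in> G" and s1: "s \<noteq> mat 1"
    and k: "\<exists>k::nat. k > 0 \<and> s [^]\<^bsub>GL\<^esub> k = mat 1"
    and "\<exists>S. hyperplane S \<and> (\<forall>x\<in>S. s *v x = x)"
    using s by (auto simp: pseudo_reflections_def pseudo_reflection_def)
  then obtain S where S: "hyperplane S" "S \<subseteq> fixed_hyperplane s"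
    by (auto simp: subset_iff mem_fixed_hyperplane)
  let ?c = "w ** s ** matrix_inv w"
  have cG: "?c \<in> G"
    by (intro G_mult G_inv w sG)
  have "matrix_inv w ** ?c ** w = (matrix_inv w ** w) ** s ** (matrix_inv w ** w)"
    by (simp only: matrix_mul_assoc)
  then have "matrix_inv w ** ?c ** w = s"
    by (simp add: G_matrix_inv w)
  then have "?c \<noteq> mat 1"
    using s1 by (auto simp: G_matrix_inv w)
  moreover have "\<exists>k::nat. k > 0 \<and> ?c [^]\<^bsub>GL\<^esub> k = mat 1"
    using k by (auto simp: GL_pow_conj G_invertible w sG G_matrix_inv)
  moreover have "hyperplane ((*v) w ` S)"
    by (intro hyperplane_image G_invertible w S)
  moreover have "(*v) w ` S \<subseteq> fixed_hyperplane ?c"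
    using S(2) by (auto simp: fixed_hyperplane_conj G_invertible w)
  ultimately show ?thesis
    using cG by (auto simp: pseudo_reflections_def pseudo_reflection_def G_invertible
        mem_fixed_hyperplane subset_iff)
qed

lemma inj_H: "i \<in> P \<Longrightarrow> j \<in> P \<Longrightarrow> H i = H j \<Longrightarrow> i = j"
  using indexes by (auto simp: indexes_hyperplanes_def bij_betw_def inj_on_def)

lemma H_image: "H ` P = fixed_hyperplane ` R"
  using indexes by (auto simp: indexes_hyperplanes_def bij_betw_def)

lemma mem_H: "i \<in> P \<Longrightarrow> x \<in> H i \<longleftrightarrow> f i x = 0"
  using form_kernel by blast

lemma idx:
  assumes "s \<in> R"
  shows "idx s \<in> P \<and> H (idx s) = fixed_hyperplane s"
proof -
  have "fixed_hyperplane s \<in> H ` P"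
    unfolding H_image using assms by (rule imageI)
  then obtain i where i: "i \<in> P" "H i = fixed_hyperplane s"
    by auto
  have "idx s = i"
    unfolding refl_index_def
  proof (rule the_equality)
    show "j = i" if "j \<in> P \<and> H j = fixed_hyperplane s" for j
      using inj_H[of j i] i that by simp
  qed (use i in simp)
  then show ?thesis
    using i by simp
qed

lemma act_unique:
  assumes j: "j \<in> P" "H j = (*v) w ` H i"
  shows "act w i = j"
  unfolding index_action_def
proof (rule the_equality)
  show "k = j" if "k \<in> P \<and> H k = (*v) w ` H i" for k
    using inj_H[of k j] j that by simp
qed (use j in simp)

lemma act:
  assumes w: "w \<in> G" and i: "i \<in> P"
  shows "act w i \<in> P \<and> H (act w i) = (*v) w ` H i"
proof -
  have "H i \<in> fixed_hyperplane ` R"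
    unfolding H_image[symmetric] using i by (rule imageI)
  then obtain s where s: "s \<in> R" "H i = fixed_hyperplane s"
    by auto
  have "(*v) w ` H i \<in> fixed_hyperplane ` R"
    using R_conj[OF s(1) w] by (auto simp: s(2) fixed_hyperplane_conj[symmetric] G_invertible w)
  then obtain j where "j \<in> P" "H j = (*v) w ` H i"
    unfolding H_image[symmetric] by (metis imageE)
  with act_unique show ?thesis
    by metis
qed

lemmas act_in_P = act[THEN conjunct1] and H_act = act[THEN conjunct2]

lemma act_mult:
  assumes "u \<in> G" "w \<in> G" "i \<in> P"
  shows "act (u ** w) i = act u (act w i)"
  by (rule act_unique)
    (use assms in \<open>auto simp: act_in_P H_act image_image matrix_vector_mul_assoc\<close>)

lemma act_one: "i \<in> P \<Longrightarrow> act (mat 1) i = i"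
  by (rule act_unique) auto

lemma act_inv:
  assumes "w \<in> G" "i \<in> P"
  shows "act (matrix_inv w) (act w i) = i" "act w (act (matrix_inv w) i) = i"
  using act_mult[of "matrix_inv w" w i] act_mult[of w "matrix_inv w" i] assms
  by (simp_all add: G_inv G_matrix_inv act_one)

lemma bij_act: "w \<in> G \<Longrightarrow> bij_betw (act w) P P"
  by (rule bij_betwI[where g = "act (matrix_inv w)"]) (auto simp: act_inv act_in_P G_inv)

lemma idx_conj:
  assumes "s \<in> R" "w \<in> G"
  shows "idx (w ** s ** matrix_inv w) = act w (idx s)"
  using idx[OF R_conj[OF assms]] idx[OF assms(1)] assms
  by (intro act_unique[symmetric]) (auto simp: fixed_hyperplane_conj G_invertible)

lemma f_act_eq_0:
  assumes "w \<in> G" "i \<in> P"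
  shows "f (act w i) (w *v x) = 0 \<longleftrightarrow> f i x = 0"
proof -
  have inj: "x = y" if "w *v x = w *v y" for x y
    using inj_matrix_vector_mult[OF G_invertible[OF assms(1)]] that by (rule injD)
  have "w *v x \<in> H (act w i) \<longleftrightarrow> x \<in> H i"
    using inj by (auto simp: H_act assms)
  then show ?thesis
    by (simp add: mem_H act_in_P assms)
qed

text \<open>The form \<open>f (act w i)\<close> composed with \<open>w\<close> has the same kernel
  as \<open>f i\<close>, so the two are proportional and the factor cancels. Thus \<open>G\<close>
  permutes the logarithmic derivatives, although it permutes the forms only up to scalars.\<close>

lemma f_act_ratio:
  assumes w: "w \<in> G" and i: "i \<in> P" and x: "f i x \<noteq> 0"
  shows "f (act w i) (w *v y) / f (act w i) (w *v x) = f i y / f i x"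
proof -
  have g: "linear_form (\<lambda>z. f (act w i) (w *v z))"
    using Vector_Spaces.linear_compose[OF matrix_vector_mul_linear_gen form[OF act_in_P[OF w i]]]
    by (simp add: o_def)
  have "f (act w i) (w *v y) = f (act w i) (w *v x) / f i x * f i y"
    by (rule linear_form_proportional[OF form[OF i] g x]) (simp add: f_act_eq_0 w i)
  moreover have "f (act w i) (w *v x) \<noteq> 0"
    using x by (simp add: f_act_eq_0 w i)
  ultimately show ?thesis
    by simp
qed

text \<open>If the kernel of \<open>f i\<close> lay in that of \<open>f j\<close>, the forms would
  be proportional with nonzero factor and \<open>H i = H j\<close>, against the injectivity of the
  indexing.\<close>

sublocale arrangement P f
proof
  show "\<exists>x. f i x = 0 \<and> f j x \<noteq> 0" if ij: "i \<in> P" "j \<in> P" "i \<noteq> j" for i j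
  proof (rule ccontr)
    assume neg: "\<not> ?thesis"
    obtain e where e: "f i e \<noteq> 0"
      using form_nonzero[OF ij(1)] by fastforce
    have proportional: "f j x = f j e / f i e * f i x" for x
      by (rule linear_form_proportional[OF form[OF ij(1)] form[OF ij(2)] e]) (use neg in auto)
    have "f j e \<noteq> 0"
      using form_nonzero[OF ij(2)] proportional by (metis div_0 mult_zero_left)
    then have "f j x = 0 \<longleftrightarrow> f i x = 0" for x
      using e by (subst proportional) simp
    then have "H i = H j"
      using mem_H ij by blast
    then show False
      using inj_H ij by blast
  qed
  show "\<exists>x. f i x \<noteq> 0" if "i \<in> P" for i
    using form_nonzero[OF that] by fastforce
qed (auto simp: linear_form_simps[OF form])

lemma regular_eq: "regular = hyperplane_complement P H"
  by (auto simp: regular_def hyperplane_complement_def mem_H)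

text \<open>A reflection with hyperplane in the pencil fixes the common kernel pointwise, so it
  sends hyperplanes through this kernel to hyperplanes through it.\<close>

lemma act_pencil:
  assumes s: "s \<in> R" "idx s \<in> pencil a b" and k: "k \<in> pencil a b"
  shows "act s k \<in> pencil a b"
proof -
  have kP: "k \<in> P"
    using k pencil_subset by auto
  have "f (act s k) x = 0" if x: "f a x = 0" "f b x = 0" for x
  proof -
    have "f (idx s) x = 0"
      using s(2) x by (simp add: pencil_def)
    then have "s *v x = x"
      using idx[OF s(1)] by (metis mem_H mem_fixed_hyperplane)
    then show ?thesis
      using f_act_eq_0[OF R_in_G[OF s(1)] kP, of x] k x by (simp add: pencil_def)
  qed
  then show ?thesis
    using act_in_P[OF R_in_G[OF s(1)] kP] by (simp add: pencil_def)
qed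

text \<open>The image of \<open>s - 1\<close> is a line. If \<open>s\<close> moved a point of \<open>H i \<inter> H k\<close>, this line would lie
  in \<open>H k\<close>, so that \<open>s\<close> would fix \<open>H k\<close> and could not move \<open>H i\<close> to it.\<close>

lemma idx_in_pencil:
  assumes s: "s \<in> R" and i: "i \<in> P" and move: "act s i \<noteq> i"
  shows "idx s \<in> pencil i (act s i)"
proof (rule ccontr)
  let ?k = "act s i" and ?h = "f (idx s)"
  have k: "?k \<in> P"
    using act_in_P[OF R_in_G[OF s] i] .
  have hP: "idx s \<in> P"
    using idx[OF s] by simp
  have fixed: "s *v x = x \<longleftrightarrow> ?h x = 0" for x
    using idx[OF s] mem_H mem_fixed_hyperplane by metis
  note h = linear_form_simps[OF form[OF hP]] and fk = linear_form_simps[OF form[OF k]]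
  assume "idx s \<notin> pencil i ?k"
  then obtain x where x: "f i x = 0" "f ?k x = 0" "?h x \<noteq> 0"
    using hP by (auto simp: pencil_def)
  have sx: "f ?k (s *v x) = 0"
    using x by (simp add: f_act_eq_0 R_in_G s i)
  have "f ?k (s *v y) = f ?k y" for y
  proof -
    \<comment> \<open>As \<open>x\<close> is transversal to the hyperplane of \<open>s\<close>,
      subtracting a multiple of it from \<open>y\<close> gives a point fixed by
      \<open>s\<close>.\<close>
    have "s *v (y - (?h y / ?h x) *s x) = y - (?h y / ?h x) *s x"
      using x by (simp add: fixed h)
    then have "s *v y = y + (?h y / ?h x) *s (s *v x) - (?h y / ?h x) *s x"
      by (simp add: matrix_vector_mult_diff_distrib vector_scalar_commute algebra_simps)
    then show ?thesis
      using x sx by (simp add: fk)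
  qed
  then have "f i y = 0 \<longleftrightarrow> f ?k y = 0" for y
    using f_act_eq_0[OF R_in_G[OF s] i, of y] by simp
  then show False
    using not_proportional[OF i k] move by auto
qed

section \<open>Permutation matrices and invariance of connections\<close>

lemma rep_nth: "rep w $ a $ b = (if a \<in> P \<and> b \<in> P \<and> a = act w b then 1 else 0)"
  by (simp add: perm_rep_def)

lemma rep_bvec: "w \<in> G \<Longrightarrow> i \<in> P \<Longrightarrow> rep w *v bvec i = bvec (act w i)"
  by (simp add: vec_eq_iff matrix_bvec rep_nth) (simp add: bvec_def axis_def act_in_P)

lemma rep_mult_left:
  assumes "w \<in> G"
  shows "(rep w ** A) $ a $ b = (if a \<in> P then A $ (act (matrix_inv w) a) $ b else 0)"
proof -
  have "rep w $ a $ c * A $ c $ b =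
      (if c = act (matrix_inv w) a then if a \<in> P then A $ (act (matrix_inv w) a) $ b else 0 else 0)" for c
    using assms by (auto simp: rep_nth act_inv act_in_P G_inv)
  then show ?thesis
    by (simp add: matrix_matrix_mult_def)
qed

lemma rep_mult_right:
  assumes "w \<in> G"
  shows "(A ** rep w) $ a $ b = (if b \<in> P then A $ a $ (act w b) else 0)"
proof -
  have "A $ a $ c * rep w $ c $ b = (if c = act w b then if b \<in> P then A $ a $ (act w b) else 0 else 0)" for c
    using assms by (auto simp: rep_nth act_in_P)
  then show ?thesis
    by (simp add: matrix_matrix_mult_def)
qed

lemma rep_conj_nth:
  assumes "w \<in> G"
  shows "(rep w ** A ** rep (matrix_inv w)) $ a $ b =
    (if a \<in> P \<and> b \<in> P then A $ (act (matrix_inv w) a) $ (act (matrix_inv w) b) else 0)"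
  by (simp add: rep_mult_right rep_mult_left G_inv assms)

text \<open>Transport by \<open>w\<close> reindexes the residues because the logarithmic derivatives
  are permuted. The two sides then differ by a logarithmic form, which vanishes only if all its
  residues do.\<close>

lemma invariant_log_form_iff:
  "invariant_connection_on G rep regular (log_form P X) \<longleftrightarrow>
   (\<forall>w\<in>G. \<forall>i\<in>P. X (act w i) = rep w ** X i ** rep (matrix_inv w))"
proof -
  have "(\<forall>x\<in>regular. \<forall>y. log_form P X (w *v x) (w *v y) = rep w ** log_form P X x y ** rep (matrix_inv w)) \<longleftrightarrow>
      (\<forall>i\<in>P. X (act w i) = rep w ** X i ** rep (matrix_inv w))" if w: "w \<in> G" for w
  proof -
    let ?D = "\<lambda>i. X (act w i) - rep w ** X i ** rep (matrix_inv w)"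
    have diff: "log_form P X (w *v x) (w *v y) - rep w ** log_form P X x y ** rep (matrix_inv w) = log_form P ?D x y"
      if x: "x \<in> regular" for x y
    proof -
      have "log_form P X (w *v x) (w *v y) =
          (\<Sum>i\<in>P. (f (act w i) (w *v y) / f (act w i) (w *v x)) *m X (act w i))"
        unfolding log_form_def
        using sum.reindex_bij_betw[OF bij_act[OF w], of "\<lambda>i. (f i (w *v y) / f i (w *v x)) *m X i"] by simp
      also have "\<dots> = (\<Sum>i\<in>P. (f i y / f i x) *m X (act w i))"
        using x by (intro sum.cong) (auto simp: f_act_ratio w regular_def)
      finally show ?thesis
        by (simp add: log_form_def matrix_sum_ldistrib matrix_sum_rdistrib cscale_mult_left
            cscale_mult_right cscale_diff_right sum_subtractf)
    qed
    have "(\<forall>x\<in>regular. \<forall>y. log_form P X (w *v x) (w *v y) = rep w ** log_form P X x y ** rep (matrix_inv w)) \<longleftrightarrow>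
        (\<forall>x\<in>regular. \<forall>y. log_form P ?D x y = 0)"
      by (simp only: diff[symmetric] right_minus_eq cong: ball_cong)
    also have "\<dots> \<longleftrightarrow> (\<forall>i\<in>P. ?D i = 0)"
    proof
      show "\<forall>x\<in>regular. \<forall>y. log_form P ?D x y = 0" if "\<forall>i\<in>P. ?D i = 0"
      proof -
        have "log_form P ?D x y = log_form P (\<lambda>_. 0) x y" for x y
          unfolding log_form_def using that by (intro sum.cong) simp_all
        then show ?thesis
          by (simp add: log_form_def vec_eq_iff)
      qed
    qed (use log_form_eq_0_imp[where X = ?D] in blast)
    finally show ?thesis
      by simp
  qed
  then show ?thesis
    by (simp add: invariant_connection_on_def)
qed

end

section \<open>The generalized Lawrence--Krammer connection\<close>

context reflection_arrangement
begin

lemma G_inv_inv: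
  assumes "w \<in> G"
  shows "matrix_inv (matrix_inv w) = w"
proof -
  have "matrix_inv (matrix_inv w) ** (matrix_inv w ** w) = w"
    unfolding matrix_mul_assoc by (simp add: G_matrix_inv G_inv assms)
  then show ?thesis
    by (simp add: G_matrix_inv assms)
qed

lemma conj_cancel:
  assumes "w \<in> G"
  shows "matrix_inv w ** (w ** s ** matrix_inv w) ** w = s"
    "w ** (matrix_inv w ** s ** w) ** matrix_inv w = s"
proof -
  have "matrix_inv w ** (w ** s ** matrix_inv w) ** w = (matrix_inv w ** w) ** s ** (matrix_inv w ** w)"
    "w ** (matrix_inv w ** s ** w) ** matrix_inv w = (w ** matrix_inv w) ** s ** (w ** matrix_inv w)"
    by (simp_all only: matrix_mul_assoc)
  then show "matrix_inv w ** (w ** s ** matrix_inv w) ** w = s"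
    "w ** (matrix_inv w ** s ** w) ** matrix_inv w = s"
    by (simp_all add: G_matrix_inv assms)
qed

lemma R_conj_inv: "s \<in> R \<Longrightarrow> w \<in> G \<Longrightarrow> matrix_inv w ** s ** w \<in> R"
  using R_conj[of s "matrix_inv w"] by (simp add: G_inv G_inv_inv)

lemma idx_conj_inv:
  "s \<in> R \<Longrightarrow> w \<in> G \<Longrightarrow> idx (matrix_inv w ** s ** w) = act (matrix_inv w) (idx s)"
  using idx_conj[of s "matrix_inv w"] by (simp add: G_inv G_inv_inv)

lemma act_conj:
  "s \<in> G \<Longrightarrow> w \<in> G \<Longrightarrow> i \<in> P \<Longrightarrow> act (w ** s ** matrix_inv w) (act w i) = act w (act s i)"
  by (simp add: act_mult G_mult G_inv act_in_P act_inv)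

lemma act_inj: "w \<in> G \<Longrightarrow> i \<in> P \<Longrightarrow> j \<in> P \<Longrightarrow> act w i = act w j \<longleftrightarrow> i = j"
  using bij_act by (auto simp: bij_betw_def inj_on_def)

lemma rep_mult: "u \<in> G \<Longrightarrow> w \<in> G \<Longrightarrow> rep u ** rep w = rep (u ** w)"
  by (auto simp: vec_eq_iff rep_mult_right rep_nth act_mult act_in_P)

lemma bij_act_pencil:
  assumes "s \<in> R" "idx s \<in> pencil a b"
  shows "bij_betw (act s) (pencil a b) (pencil a b)"
proof -
  have inj: "inj_on (act s) (pencil a b)"
    using bij_betw_imp_inj_on[OF bij_act[OF R_in_G[OF assms(1)]]] pencil_subset
    by (rule inj_on_subset)
  moreover have "act s ` pencil a b = pencil a b"
    using act_pencil[OF assms] finite_subset[OF pencil_subset finite_P] inj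
    by (intro endo_inj_surj) auto
  ultimately show ?thesis
    by (simp add: bij_betw_def)
qed

lemma act_pencil_iff:
  assumes s: "s \<in> R" "idx s \<in> pencil a b" and k: "k \<in> P"
  shows "act s k \<in> pencil a b \<longleftrightarrow> k \<in> pencil a b"
proof
  assume "act s k \<in> pencil a b"
  then obtain k' where "k' \<in> pencil a b" "act s k = act s k'"
    using bij_betw_imp_surj_on[OF bij_act_pencil[OF s]] by (metis imageE)
  then show "k \<in> pencil a b"
    using act_inj[OF R_in_G[OF s(1)] k] pencil_subset by (metis subsetD)
qed (rule act_pencil[OF s])

end

section \<open>Matrix entries and equivariance of the residues\<close>

locale LK_connection_data = reflection_arrangement G P H f
  for G :: "(complex ^ 'n ^ 'n) set"
    and P :: "'p::finite set"
    and H :: "'p \<Rightarrow> (complex ^ 'n) set"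
    and f :: "'p \<Rightarrow> complex ^ 'n \<Rightarrow> complex" +
  fixes \<mu> :: "complex ^ 'n ^ 'n \<Rightarrow> complex"
    and p :: "'p \<Rightarrow> complex ^ 'p ^ 'p"
    and m :: "'p \<Rightarrow> complex"
    and \<alpha> :: "'p \<Rightarrow> 'p \<Rightarrow> complex"
  assumes \<mu>_conj: "s \<in> pseudo_reflections G \<Longrightarrow> t \<in> pseudo_reflections G \<Longrightarrow>
      conjugate_in G s t \<Longrightarrow> \<mu> s = \<mu> t"
    and p_End: "i \<in> P \<Longrightarrow> p i \<in> End_VG P"
    and p_diagonal: "i \<in> P \<Longrightarrow> p i *v bvec i = m i *s bvec i"
    and p_off_diagonal: "i \<in> P \<Longrightarrow> j \<in> P \<Longrightarrow> j \<noteq> i \<Longrightarrow> p i *v bvec j = \<alpha> i j *s bvec i"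
begin

text \<open>The only row of \<open>p i\<close> that can be nonzero, with diagonal and off-diagonal
  entries in one family so that invariance is a single condition.\<close>

definition A :: "'p \<Rightarrow> 'p \<Rightarrow> complex" where
  "A i j = (if j = i then m i else \<alpha> i j)"

definition T :: "'p \<Rightarrow> complex ^ 'p ^ 'p" where
  "T i = (\<Sum>s | s \<in> R \<and> idx s = i. \<mu> s *m rep s)"

definition X :: "'p \<Rightarrow> complex ^ 'p ^ 'p" where
  "X i = T i - p i"

text \<open>Transition sums from \<open>j\<close> to \<open>i\<close>: with \<open>S = P\<close>
  they are the right side of condition (2), with a singleton the entries of a group part
  \<open>T\<close>, and with a pencil those of the group part of the pencil sum.\<close>

definition \<beta> :: "'p set \<Rightarrow> 'p \<Rightarrow> 'p \<Rightarrow> complex" where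
  "\<beta> S i j = (\<Sum>s | s \<in> R \<and> idx s \<in> S \<and> act s j = i. \<mu> s)"

lemma LK_connection_eq: "LK_connection G P H f \<kappa> \<mu> p = log_form P (\<lambda>i. \<kappa> *m X i)"
proof (intro ext)
  fix x y
  show "LK_connection G P H f \<kappa> \<mu> p x y = log_form P (\<lambda>i. \<kappa> *m X i) x y"
    unfolding LK_connection_def log_form_def cscale_sum_right
    by (intro sum.cong) (simp_all add: dlog_linear_form form X_def T_def cscale_cscale mult.commute)
qed

lemma \<mu>_conj_eq:
  assumes "s \<in> R" "w \<in> G"
  shows "\<mu> (w ** s ** matrix_inv w) = \<mu> s"
proof -
  have "conjugate_in G s (w ** s ** matrix_inv w)"
    using assms(2) by (auto simp: conjugate_in_def)
  then show ?thesis
    using \<mu>_conj[OF assms(1) R_conj[OF assms]] by simp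
qed

lemma \<mu>_conj_inv: "s \<in> R \<Longrightarrow> w \<in> G \<Longrightarrow> \<mu> (matrix_inv w ** s ** w) = \<mu> s"
  using \<mu>_conj_eq[of s "matrix_inv w"] by (simp add: G_inv G_inv_inv)

lemma p_nth:
  assumes "i \<in> P"
  shows "p i $ a $ b = (if a = i \<and> b \<in> P then A i b else 0)"
proof (cases "b \<in> P")
  case True
  have "p i $ a $ b = (p i *v bvec b) $ a"
    by (simp add: matrix_bvec)
  then show ?thesis
    using True p_diagonal[OF assms] p_off_diagonal[OF assms True]
    by (auto simp: A_def bvec_def axis_def)
next
  case False
  then show ?thesis
    using p_End[OF assms] by (simp add: End_VG_def)
qed

lemma T_nth: "T i $ a $ b = (if a \<in> P \<and> b \<in> P then \<beta> {i} a b else 0)"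
proof -
  have "T i $ a $ b = (\<Sum>s | s \<in> R \<and> idx s = i. if a \<in> P \<and> b \<in> P \<and> a = act s b then \<mu> s else 0)"
    by (simp add: T_def rep_nth if_distrib cong: if_cong)
  also have "\<dots> = (if a \<in> P \<and> b \<in> P then \<beta> {i} a b else 0)"
    unfolding \<beta>_def
    by (auto intro!: sum.mono_neutral_cong_right finite_subset[OF _ finite_R] split: if_splits)
  finally show ?thesis .
qed

lemma X_nth_outside: "i \<in> P \<Longrightarrow> a \<notin> P \<or> b \<notin> P \<Longrightarrow> X i $ a $ b = 0"
  by (auto simp: X_def T_nth p_nth)

lemma sum_X_nth:
  assumes "S \<subseteq> P"
  shows "(\<Sum>k\<in>S. X k) $ a $ b =
    (if a \<in> P \<and> b \<in> P then \<beta> S a b - (if a \<in> S then A a b else 0) else 0)"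
proof -
  have fin: "finite S"
    using assms finite_P finite_subset by auto
  have "(\<Sum>k\<in>S. \<beta> {k} a b) = \<beta> S a b"
  proof -
    have "\<beta> {k} a b = (\<Sum>s\<in>{s \<in> {s. s \<in> R \<and> idx s \<in> S \<and> act s b = a}. idx s = k}. \<mu> s)" if "k \<in> S" for k
      unfolding \<beta>_def using that by (intro sum.cong) auto
    then have "(\<Sum>k\<in>S. \<beta> {k} a b) = (\<Sum>k\<in>S. (\<Sum>s\<in>{s \<in> {s. s \<in> R \<and> idx s \<in> S \<and> act s b = a}. idx s = k}. \<mu> s))"
      by simp
    also have "\<dots> = \<beta> S a b"
      unfolding \<beta>_def by (rule sum.group) (auto intro: finite_subset[OF _ finite_R] fin)
    finally show ?thesis .
  qed
  moreover have "(\<Sum>k\<in>S. p k $ a $ b) = (if a \<in> S \<and> b \<in> P then A a b else 0)"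
  proof -
    have "(\<Sum>k\<in>S. p k $ a $ b) = (\<Sum>k\<in>S. if k = a then if b \<in> P then A a b else 0 else 0)"
      using assms by (intro sum.cong) (auto simp: p_nth)
    then show ?thesis
      using fin by simp
  qed
  ultimately show ?thesis
    using assms by (auto simp: X_def T_nth sum_subtractf)
qed

lemma T_act:
  assumes w: "w \<in> G" and i: "i \<in> P"
  shows "T (act w i) = rep w ** T i ** rep (matrix_inv w)"
proof -
  \<comment> \<open>Conjugation by \<open>w\<close> maps the reflections with hyperplane
    \<open>H i\<close> onto those with hyperplane \<open>H (act w i)\<close>, and \<mu> takes equal
    values on conjugate reflections.\<close>
  have "T (act w i) = (\<Sum>s | s \<in> R \<and> idx s = i. \<mu> s *m rep (w ** s ** matrix_inv w))"
    unfolding T_def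
    by (rule sum.reindex_bij_witness[where i = "\<lambda>s. w ** s ** matrix_inv w"
          and j = "\<lambda>s. matrix_inv w ** s ** w"])
      (use w i in \<open>auto simp: conj_cancel R_conj R_conj_inv idx_conj idx_conj_inv \<mu>_conj_inv act_inv\<close>)
  also have "\<dots> = (\<Sum>s | s \<in> R \<and> idx s = i. \<mu> s *m (rep w ** rep s ** rep (matrix_inv w)))"
    by (intro sum.cong) (auto simp: rep_mult G_mult G_inv w R_in_G)
  finally show ?thesis
    by (simp add: T_def matrix_sum_ldistrib matrix_sum_rdistrib cscale_mult_left cscale_mult_right)
qed

text \<open>Conjugation by \<open>w\<close> matches the reflections taking \<open>j\<close> to
  \<open>i\<close> with those taking \<open>act w j\<close> to \<open>act w i\<close>, and does not
  change \<mu>.\<close>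

lemma \<beta>_act:
  assumes w: "w \<in> G" and ij: "i \<in> P" "j \<in> P"
  shows "\<beta> P (act w i) (act w j) = \<beta> P i j"
  unfolding \<beta>_def
proof (rule sum.reindex_bij_witness[where i = "\<lambda>s. w ** s ** matrix_inv w"
      and j = "\<lambda>s. matrix_inv w ** s ** w"])
  fix s assume s: "s \<in> {s \<in> R. idx s \<in> P \<and> act s (act w j) = act w i}"
  let ?t = "matrix_inv w ** s ** w"
  have t: "?t \<in> R"
    using R_conj_inv s w by auto
  have eq: "w ** ?t ** matrix_inv w = s"
    by (rule conj_cancel(2)[OF w])
  then show "w ** ?t ** matrix_inv w = s" .
  show "\<mu> ?t = \<mu> s"
    using s w by (simp add: \<mu>_conj_inv)
  have "act w (act ?t j) = act w i"
    using act_conj[OF R_in_G[OF t] w ij(2)] eq s by simp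
  then have "act ?t j = i"
    using act_inj[OF w act_in_P[OF R_in_G[OF t] ij(2)] ij(1)] by simp
  then show "?t \<in> {s \<in> R. idx s \<in> P \<and> act s j = i}"
    using t idx by simp
next
  fix s assume s: "s \<in> {s \<in> R. idx s \<in> P \<and> act s j = i}"
  show "matrix_inv w ** (w ** s ** matrix_inv w) ** w = s"
    by (rule conj_cancel(1)[OF w])
  show "w ** s ** matrix_inv w \<in> {s \<in> R. idx s \<in> P \<and> act s (act w j) = act w i}"
    using s idx[OF R_conj[OF _ w]] by (simp add: R_conj w act_conj R_in_G ij)
qed

definition A_invariant :: bool where
  "A_invariant \<longleftrightarrow> (\<forall>w\<in>G. \<forall>i\<in>P. \<forall>j\<in>P. A (act w i) (act w j) = A i j)"

text \<open>The group parts \<open>T i\<close> are always equivariant, so only the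
  \<open>p i\<close> matter; for these the condition is read off entrywise from the row
  \<open>A i\<close>.\<close>

lemma X_equivariant_iff:
  "(\<forall>w\<in>G. \<forall>i\<in>P. X (act w i) = rep w ** X i ** rep (matrix_inv w)) \<longleftrightarrow> A_invariant"
proof -
  have "X (act w i) = rep w ** X i ** rep (matrix_inv w) \<longleftrightarrow>
      (\<forall>j\<in>P. A (act w i) (act w j) = A i j)" if w: "w \<in> G" and i: "i \<in> P" for w i
  proof -
    have "X (act w i) = rep w ** X i ** rep (matrix_inv w) \<longleftrightarrow>
        p (act w i) = rep w ** p i ** rep (matrix_inv w)"
      by (simp add: X_def T_act w i matrix_diff_ldistrib matrix_diff_rdistrib)
    also have "\<dots> \<longleftrightarrow> (\<forall>j\<in>P. A (act w i) j = A i (act (matrix_inv w) j))"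
    proof
      assume eq: "p (act w i) = rep w ** p i ** rep (matrix_inv w)"
      show "\<forall>j\<in>P. A (act w i) j = A i (act (matrix_inv w) j)"
      proof
        fix j assume "j \<in> P"
        then show "A (act w i) j = A i (act (matrix_inv w) j)"
          using arg_cong[OF eq, of "\<lambda>B. B $ act w i $ j"] w i
          by (simp add: rep_conj_nth p_nth act_in_P act_inv G_inv)
      qed
    next
      assume "\<forall>j\<in>P. A (act w i) j = A i (act (matrix_inv w) j)"
      then show "p (act w i) = rep w ** p i ** rep (matrix_inv w)"
        using w i by (auto simp: vec_eq_iff rep_conj_nth p_nth act_in_P act_inv G_inv)
    qed
    also have "\<dots> \<longleftrightarrow> (\<forall>j\<in>P. A (act w i) (act w j) = A i j)"
      using w by (metis act_in_P act_inv G_inv)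
    finally show ?thesis .
  qed
  then show ?thesis
    by (simp add: A_invariant_def)
qed

lemma invariant_LK:
  assumes A_invariant
  shows "invariant_connection_on G rep regular (log_form P (\<lambda>i. \<kappa> *m X i))"
proof -
  have "X (act w i) = rep w ** X i ** rep (matrix_inv w)" if "w \<in> G" "i \<in> P" for w i
    using X_equivariant_iff assms that by blast
  then show ?thesis
    by (simp add: invariant_log_form_iff cscale_mult_left cscale_mult_right)
qed

lemma A_invariant_if_invariant_LK:
  assumes "invariant_connection_on G rep regular (log_form P (\<lambda>i. \<kappa> *m X i))" and "\<kappa> \<noteq> 0"
  shows A_invariant
proof -
  have "X (act w i) = rep w ** X i ** rep (matrix_inv w)" if "w \<in> G" "i \<in> P" for w i
  proof -
    have "\<kappa> *m X (act w i) = \<kappa> *m (rep w ** X i ** rep (matrix_inv w))"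
      using assms(1) that by (simp add: invariant_log_form_iff cscale_mult_left cscale_mult_right)
    then show ?thesis
      using assms(2) by (simp add: vec_eq_iff)
  qed
  then show ?thesis
    using X_equivariant_iff by blast
qed

text \<open>In general \<open>rep (matrix_inv w) ** rep w\<close> is only the projection to the
  coordinates in \<open>P\<close>, so it cannot be cancelled as an identity matrix. The entries are
  compared instead, those outside \<open>P\<close> being zero.\<close>

lemma rep_mult_X:
  assumes inv: A_invariant and w: "w \<in> G" and k: "k \<in> P"
  shows "rep w ** X k = X (act w k) ** rep w"
proof -
  have eq: "X (act w k) = rep w ** X k ** rep (matrix_inv w)"
    using X_equivariant_iff inv w k by blast
  have "(rep w ** X k) $ a $ b = (X (act w k) ** rep w) $ a $ b" for a b
    unfolding rep_mult_right[OF w] rep_mult_left[OF w] eq rep_conj_nth[OF w]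
    using w k by (simp add: act_in_P act_inv X_nth_outside)
  then show ?thesis
    by (simp add: vec_eq_iff)
qed

text \<open>By equivariance each \<open>s\<close> with hyperplane in a pencil permutes the residues of that pencil,
  so their sum commutes with \<open>s\<close>.\<close>

lemma commutator_T_pencil:
  assumes inv: A_invariant and i: "i \<in> pencil a b"
  shows "commutator (T i) (\<Sum>k\<in>pencil a b. X k) = 0"
proof -
  let ?S = "pencil a b"
  have "commutator (rep s) (\<Sum>k\<in>?S. X k) = 0" if s: "s \<in> R" "idx s = i" for s
  proof -
    have "rep s ** (\<Sum>k\<in>?S. X k) = (\<Sum>k\<in>?S. X (act s k) ** rep s)"
      unfolding matrix_sum_ldistrib using rep_mult_X[OF inv R_in_G[OF s(1)]] pencil_subset
      by (intro sum.cong) auto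
    also have "\<dots> = (\<Sum>k\<in>?S. X k ** rep s)"
      by (rule sum.reindex_bij_betw[OF bij_act_pencil]) (use s i in auto)
    finally show ?thesis
      by (simp add: commutator_def matrix_sum_rdistrib)
  qed
  then show ?thesis
    unfolding T_def commutator_sum_left commutator_cscale_left
    by (intro sum.neutral) (auto simp: vec_eq_iff)
qed

lemma commutator_X_pencil:
  assumes "A_invariant" "i \<in> pencil a b"
  shows "commutator (X i) (\<Sum>k\<in>pencil a b. X k) = - commutator (p i) (\<Sum>k\<in>pencil a b. X k)"
  using commutator_T_pencil[OF assms] commutator_add_left[of "X i" "p i"]
  by (simp add: X_def eq_neg_iff_add_eq_0)

section \<open>Commutation of the \<open>p i\<close> with the pencil sums\<close>

lemma p_mult_nth:
  assumes "i \<in> P"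
  shows "(p i ** B) $ a $ j = (if a = i then \<Sum>b\<in>P. A i b * B $ b $ j else 0)"
proof -
  have "(\<Sum>b\<in>UNIV. p i $ i $ b * B $ b $ j) = (\<Sum>b\<in>P. A i b * B $ b $ j)"
    by (rule sum.mono_neutral_cong_right) (auto simp: p_nth assms)
  then show ?thesis
    by (simp add: matrix_matrix_mult_def p_nth assms)
qed

lemma mult_p_nth:
  assumes "i \<in> P"
  shows "(B ** p i) $ a $ j = (if j \<in> P then B $ a $ i * A i j else 0)"
proof -
  have "B $ a $ b * p i $ b $ j = (if b = i then if j \<in> P then B $ a $ i * A i j else 0 else 0)" for b
    by (simp add: p_nth assms)
  then show ?thesis
    by (simp add: matrix_matrix_mult_def)
qed

text \<open>By \<open>idx_in_pencil\<close> a reflection taking \<open>j\<close> to a different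
  \<open>i\<close> has its hyperplane in the pencil of \<open>j\<close> and \<open>i\<close>, which
  is the given one by \<open>pencil_eq\<close>. So restricting the sum to the pencil loses
  nothing.\<close>

lemma \<beta>_pencil:
  assumes ab: "a \<in> P" "b \<in> P" "a \<noteq> b" and ij: "i \<in> pencil a b" "j \<in> pencil a b" "i \<noteq> j"
  shows "\<beta> (pencil a b) i j = \<beta> P i j"
proof -
  have "idx s \<in> pencil a b" if s: "s \<in> R" "act s j = i" for s
  proof -
    have "j \<in> P"
      using ij pencil_subset by auto
    then have "idx s \<in> pencil j i"
      using idx_in_pencil[of s j] s ij by auto
    then show ?thesis
      using pencil_eq[OF ab ij(2,1)] ij(3) by simp
  qed
  then show ?thesis
    unfolding \<beta>_def using idx by (intro sum.cong) auto
qed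

text \<open>Each reflection is counted once, at its image of \<open>j\<close>; this rewrites a row
  vector times the transition matrix as a sum over reflections.\<close>

lemma sum_mult_\<beta>:
  assumes j: "j \<in> P"
  shows "(\<Sum>b\<in>P. g b * \<beta> S b j) = (\<Sum>s | s \<in> R \<and> idx s \<in> S. \<mu> s * g (act s j))"
proof -
  have "g b * \<beta> S b j = (\<Sum>s\<in>{s \<in> {s. s \<in> R \<and> idx s \<in> S}. act s j = b}. \<mu> s * g (act s j))" for b
    unfolding \<beta>_def sum_distrib_left by (intro sum.cong) auto
  then have "(\<Sum>b\<in>P. g b * \<beta> S b j) = (\<Sum>b\<in>P. \<Sum>s\<in>{s \<in> {s. s \<in> R \<and> idx s \<in> S}. act s j = b}. \<mu> s * g (act s j))"
    by simp
  also have "\<dots> = (\<Sum>s | s \<in> R \<and> idx s \<in> S. \<mu> s * g (act s j))"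
    by (rule sum.group) (auto simp: finite_P act_in_P R_in_G j intro: finite_subset[OF _ finite_R])
  finally show ?thesis .
qed

text \<open>The column version of \<open>sum_mult_\<beta>\<close>: each reflection is counted at its
  preimage of \<open>i\<close>.\<close>

lemma sum_\<beta>_mult:
  assumes i: "i \<in> P"
  shows "(\<Sum>k\<in>P. \<beta> S i k * g k) = (\<Sum>s | s \<in> R \<and> idx s \<in> S. \<mu> s * g (act (matrix_inv s) i))"
proof -
  have "\<beta> S i k * g k =
      (\<Sum>s\<in>{s \<in> {s. s \<in> R \<and> idx s \<in> S}. act (matrix_inv s) i = k}. \<mu> s * g (act (matrix_inv s) i))"
    if "k \<in> P" for k
    unfolding \<beta>_def sum_distrib_right
    by (intro sum.cong) (use i that R_in_G in \<open>auto simp: act_inv\<close>)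
  then have "(\<Sum>k\<in>P. \<beta> S i k * g k) = (\<Sum>k\<in>P. \<Sum>s\<in>{s \<in> {s. s \<in> R \<and> idx s \<in> S}. act (matrix_inv s) i = k}.
      \<mu> s * g (act (matrix_inv s) i))"
    by simp
  also have "\<dots> = (\<Sum>s | s \<in> R \<and> idx s \<in> S. \<mu> s * g (act (matrix_inv s) i))"
    by (rule sum.group) (auto simp: finite_P act_in_P R_in_G G_inv i intro: finite_subset[OF _ finite_R])
  finally show ?thesis .
qed

text \<open>The transition sums make every \<open>v\<^sub>i\<close> with \<open>i\<close> in the pencil an eigenvector of the sum of the
  residues of the pencil; equivariance gives the same eigenvalue on the dual side.\<close>

lemma commutator_p_pencil:
  assumes inv: A_invariant and A: "\<And>i j. i \<in> P \<Longrightarrow> j \<in> P \<Longrightarrow> i \<noteq> j \<Longrightarrow> A i j = \<beta> P i j"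
    and ab: "a \<in> P" "b \<in> P" "a \<noteq> b" and i: "i \<in> pencil a b"
  shows "commutator (p i) (\<Sum>k\<in>pencil a b. X k) = 0"
proof -
  let ?S = "pencil a b"
  let ?B = "\<Sum>k\<in>?S. X k"
  have iP: "i \<in> P"
    using i pencil_subset by auto
  have B_nth: "?B $ c $ d = (if c \<in> P \<and> d \<in> P then \<beta> ?S c d - (if c \<in> ?S then A c d else 0) else 0)" for c d
    by (rule sum_X_nth[OF pencil_subset])
  \<comment> \<open>A reflection with hyperplane in the pencil preserves the pencil, so there are no
    transitions between its inside and its outside.\<close>
  have \<beta>0: "\<beta> ?S c d = 0" if "d \<in> P" "(c \<in> ?S) \<noteq> (d \<in> ?S)" for c d
    unfolding \<beta>_def using act_pencil_iff[OF _ _ that(1)] that(2) by (intro sum.neutral) auto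
  \<comment> \<open>Inside the pencil condition (2) cancels the off-diagonal entries; outside it
    there are no transitions.\<close>
  have off: "?B $ c $ d = 0" if "d \<in> ?S" "c \<noteq> d" for c d
  proof (cases "c \<in> ?S")
    case True
    then show ?thesis
      unfolding B_nth using that A \<beta>_pencil[OF ab True that(1,2)] pencil_subset by auto
  next
    case False
    then show ?thesis
      unfolding B_nth using that \<beta>0[of d c] pencil_subset by auto
  qed
  have row: "(\<Sum>k\<in>P. A i k * ?B $ k $ j) = ?B $ i $ i * A i j" if j: "j \<in> P" for j
  proof -
    have "(\<Sum>k\<in>P. A i k * ?B $ k $ j) =
        (\<Sum>k\<in>P. A i k * \<beta> ?S k j) - (\<Sum>k\<in>P. A i k * (if k \<in> ?S then A k j else 0))"
      unfolding sum_subtractf[symmetric] B_nth using j by (intro sum.cong) (auto simp: algebra_simps)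
    also have "(\<Sum>k\<in>P. A i k * \<beta> ?S k j) = (\<Sum>s | s \<in> R \<and> idx s \<in> ?S. \<mu> s * A i (act s j))"
      by (rule sum_mult_\<beta>[OF j])
    \<comment> \<open>Invariance of \<open>A\<close> under \<open>s\<close> moves the reflection
      from the second index to the first, which exchanges the row sum for a column sum.\<close>
    also have "\<dots> = (\<Sum>s | s \<in> R \<and> idx s \<in> ?S. \<mu> s * A (act (matrix_inv s) i) j)"
    proof (intro sum.cong refl)
      fix s assume "s \<in> {s. s \<in> R \<and> idx s \<in> ?S}"
      then have s: "s \<in> G"
        using R_in_G by auto
      then have "A (act s (act (matrix_inv s) i)) (act s j) = A (act (matrix_inv s) i) j"
        using inv iP j by (auto simp: A_invariant_def act_in_P G_inv)
      then show "\<mu> s * A i (act s j) = \<mu> s * A (act (matrix_inv s) i) j"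
        using s iP by (simp add: act_inv)
    qed
    also have "\<dots> = (\<Sum>k\<in>P. \<beta> ?S i k * A k j)"
      by (rule sum_\<beta>_mult[OF iP, symmetric])
    \<comment> \<open>Only \<open>k = i\<close> survives: other \<open>k\<close> in the pencil give
      off-diagonal entries of \<open>?B\<close>, and \<open>k\<close> outside it give vanishing
      transition sums.\<close>
    also have "(\<Sum>k\<in>P. \<beta> ?S i k * A k j) - (\<Sum>k\<in>P. A i k * (if k \<in> ?S then A k j else 0)) =
        (\<Sum>k\<in>P. if k = i then ?B $ i $ i * A i j else 0)"
      unfolding sum_subtractf[symmetric]
    proof (intro sum.cong refl)
      fix k assume k: "k \<in> P"
      show "\<beta> ?S i k * A k j - A i k * (if k \<in> ?S then A k j else 0) =
          (if k = i then ?B $ i $ i * A i j else 0)"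
      proof (cases "k \<in> ?S")
        case True
        have "\<beta> ?S i k * A k j - A i k * (if k \<in> ?S then A k j else 0) = ?B $ i $ k * A k j"
          unfolding B_nth using True i k iP by (simp add: left_diff_distrib)
        then show ?thesis
          using off[OF True, of i] by auto
      next
        case False
        then show ?thesis
          using \<beta>0[OF k, of i] i by auto
      qed
    qed
    also have "\<dots> = ?B $ i $ i * A i j"
      using iP finite_P by simp
    finally show ?thesis .
  qed
  have "(p i ** ?B) $ c $ j = (?B ** p i) $ c $ j" for c j
  proof (cases "c = i")
    case True
    show ?thesis
    proof (cases "j \<in> P")
      case True
      then show ?thesis
        unfolding p_mult_nth[OF iP] mult_p_nth[OF iP] using \<open>c = i\<close> by (simp only: row simp_thms if_True)
    next
      case False
      then show ?thesis
        unfolding p_mult_nth[OF iP] mult_p_nth[OF iP] by (simp only: B_nth) simp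
    qed
  next
    case False
    then show ?thesis
      unfolding p_mult_nth[OF iP] mult_p_nth[OF iP] using off[OF i False] by simp
  qed
  then show ?thesis
    by (simp add: commutator_def vec_eq_iff)
qed

text \<open>Row \<open>k\<close> of \<open>p i ** ?B\<close> vanishes because \<open>k\<close>
  differs from \<open>i\<close>, so \<open>?B $ k $ i * A i j\<close> is zero for every
  \<open>j\<close> in \<open>P\<close>. A nonzero entry \<open>A i j\<close> then kills
  \<open>?B $ k $ i\<close>, which is a transition sum minus \<open>A k i\<close>.\<close>

lemma A_eq_\<beta>_if_commutator_p_pencil:
  assumes comm: "commutator (p i) (\<Sum>j\<in>pencil i k. X j) = 0" and "p i \<noteq> 0"
    and ik: "i \<in> P" "k \<in> P" "i \<noteq> k"
  shows "A k i = \<beta> P k i"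
proof -
  let ?B = "\<Sum>j\<in>pencil i k. X j"
  note mem = pencil_members[OF ik(1,2)]
  obtain a j where "p i $ a $ j \<noteq> 0"
    using \<open>p i \<noteq> 0\<close> by (auto simp: vec_eq_iff)
  then have j: "j \<in> P" "A i j \<noteq> 0"
    by (auto simp: p_nth ik split: if_splits)
  have "(p i ** ?B) $ k $ j = (?B ** p i) $ k $ j"
    using comm by (simp add: commutator_def)
  then have "?B $ k $ i = 0"
    unfolding p_mult_nth[OF ik(1)] mult_p_nth[OF ik(1)] using j ik by simp
  then have "\<beta> (pencil i k) k i = A k i"
    unfolding sum_X_nth[OF pencil_subset] using mem ik by simp
  then show ?thesis
    using \<beta>_pencil[OF ik, of k i] mem ik by simp
qed

section \<open>Flatness, invariance and the two conditions\<close>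

lemma flat_LK_iff:
  assumes "A_invariant" "\<kappa> \<noteq> 0"
  shows "flat_connection_on regular (log_form P (\<lambda>i. \<kappa> *m X i)) \<longleftrightarrow>
    (\<forall>i\<in>P. \<forall>k\<in>P. i \<noteq> k \<longrightarrow> commutator (p i) (\<Sum>j\<in>pencil i k. X j) = 0)"
proof -
  have "commutator (\<kappa> *m X i) (\<Sum>j\<in>pencil i k. \<kappa> *m X j) = 0 \<longleftrightarrow>
      commutator (p i) (\<Sum>j\<in>pencil i k. X j) = 0" if "i \<in> P" "k \<in> P" for i k
  proof -
    have "commutator (\<kappa> *m X i) (\<Sum>j\<in>pencil i k. \<kappa> *m X j) =
        (\<kappa> * \<kappa>) *m commutator (X i) (\<Sum>j\<in>pencil i k. X j)"
      by (simp only: cscale_sum_right[symmetric] commutator_cscale_left commutator_cscale_right cscale_cscale)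
    also have "\<dots> = 0 \<longleftrightarrow> commutator (X i) (\<Sum>j\<in>pencil i k. X j) = 0"
      using \<open>\<kappa> \<noteq> 0\<close> by (simp add: vec_eq_iff)
    finally show ?thesis
      using commutator_X_pencil[OF \<open>A_invariant\<close>, of i i k] pencil_members[OF that] by simp
  qed
  then show ?thesis
    by (simp add: flat_log_form_iff)
qed

lemma flat_LK_zero: "flat_connection_on regular (log_form P (\<lambda>i. 0 *m X i))"
proof -
  have "(\<lambda>i. 0 *m X i) = (\<lambda>_. 0)"
    by (simp add: vec_eq_iff fun_eq_iff)
  then show ?thesis
    by (simp add: flat_log_form_iff commutator_def)
qed

text \<open>Under condition (2) the off-diagonal entries of \<open>A\<close> are transition sums,
  invariant by \<open>\<beta>_act\<close>; only the diagonal entries remain to be compared.\<close>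

lemma A_invariant_iff_m:
  assumes "\<And>i j. i \<in> P \<Longrightarrow> j \<in> P \<Longrightarrow> i \<noteq> j \<Longrightarrow> \<alpha> i j = \<beta> P i j"
  shows "A_invariant \<longleftrightarrow> (\<forall>w\<in>G. \<forall>i\<in>P. m (act w i) = m i)"
proof
  assume "A_invariant"
  then show "\<forall>w\<in>G. \<forall>i\<in>P. m (act w i) = m i"
    by (metis A_def A_invariant_def)
next
  assume m: "\<forall>w\<in>G. \<forall>i\<in>P. m (act w i) = m i"
  show "A_invariant"
    unfolding A_invariant_def
  proof (intro ballI)
    fix w i j assume "w \<in> G" "i \<in> P" "j \<in> P"
    then show "A (act w i) (act w j) = A i j"
      using m by (auto simp: A_def act_inj assms act_in_P \<beta>_act)
  qed
qed

definition LK_conditions :: bool where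
  "LK_conditions \<longleftrightarrow>
    (\<forall>w\<in>G. \<forall>i\<in>P. m (act w i) = m i) \<and> (\<forall>i\<in>P. \<forall>j\<in>P. i \<noteq> j \<longrightarrow> \<alpha> i j = \<beta> P i j)"

lemma LK_conditions_eq:
  "LK_conditions \<longleftrightarrow>
    (\<forall>i\<in>P. \<forall>j\<in>P. (\<exists>w\<in>G. rep w *v bvec i = bvec j) \<longrightarrow> m i = m j) \<and>
    (\<forall>i\<in>P. \<forall>j\<in>P. i \<noteq> j \<longrightarrow> \<alpha> i j = (\<Sum>s | s \<in> R \<and> rep s *v bvec j = bvec i. \<mu> s))"
proof -
  have "(\<forall>w\<in>G. \<forall>i\<in>P. m (act w i) = m i) \<longleftrightarrow>
      (\<forall>i\<in>P. \<forall>j\<in>P. (\<exists>w\<in>G. rep w *v bvec i = bvec j) \<longrightarrow> m i = m j)"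
    by (simp add: rep_bvec) (metis act_in_P)
  moreover have "(\<Sum>s | s \<in> R \<and> rep s *v bvec j = bvec i. \<mu> s) = \<beta> P i j" if "j \<in> P" for i j
    unfolding \<beta>_def using that idx by (intro sum.cong) (auto simp: rep_bvec R_in_G)
  ultimately show ?thesis
    by (simp add: LK_conditions_def)
qed

lemma flat_and_invariant_if_conditions:
  assumes LK_conditions
  shows "flat_connection_on regular (log_form P (\<lambda>i. \<kappa> *m X i))"
    and "invariant_connection_on G rep regular (log_form P (\<lambda>i. \<kappa> *m X i))"
proof -
  have \<alpha>: "\<alpha> i j = \<beta> P i j" if "i \<in> P" "j \<in> P" "i \<noteq> j" for i j
    using assms that by (simp add: LK_conditions_def)
  have inv: A_invariant
    using A_invariant_iff_m[OF \<alpha>] assms by (simp add: LK_conditions_def)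
  then show "invariant_connection_on G rep regular (log_form P (\<lambda>i. \<kappa> *m X i))"
    by (rule invariant_LK)
  have "commutator (p i) (\<Sum>j\<in>pencil i k. X j) = 0" if "i \<in> P" "k \<in> P" "i \<noteq> k" for i k
    using commutator_p_pencil[OF inv _ that, of i] pencil_members[OF that(1,2)] \<alpha>
    by (auto simp: A_def)
  \<comment> \<open>The criterion \<open>flat_LK_iff\<close> requires nonzero \<kappa>; for \<kappa>
    = 0 the connection is zero.\<close>
  then show "flat_connection_on regular (log_form P (\<lambda>i. \<kappa> *m X i))"
    using flat_LK_iff[OF inv] flat_LK_zero by (cases "\<kappa> = 0") auto
qed

lemma conditions_if_flat_and_invariant:
  assumes flat: "flat_connection_on regular (log_form P (\<lambda>i. \<kappa> *m X i))"
    and inv: "invariant_connection_on G rep regular (log_form P (\<lambda>i. \<kappa> *m X i))"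
    and "\<kappa> \<noteq> 0" and p: "\<And>i. i \<in> P \<Longrightarrow> p i \<noteq> 0"
  shows LK_conditions
proof -
  have A: A_invariant
    by (rule A_invariant_if_invariant_LK[OF inv \<open>\<kappa> \<noteq> 0\<close>])
  \<comment> \<open>The indices are exchanged: commutation with \<open>p j\<close>, not with
    \<open>p i\<close>, determines \<open>\<alpha> i j\<close>, the coefficient in the
    \<open>i\<close>-component of the pencil sum applied to \<open>bvec j\<close>.\<close>
  have \<alpha>: "\<alpha> i j = \<beta> P i j" if "i \<in> P" "j \<in> P" "i \<noteq> j" for i j
    using A_eq_\<beta>_if_commutator_p_pencil[of j i] flat flat_LK_iff[OF A \<open>\<kappa> \<noteq> 0\<close>] p that
    by (simp add: A_def)
  then show ?thesis
    using A_invariant_iff_m[OF \<alpha>] A by (simp add: LK_conditions_def)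
qed

end

text \<open>For \<kappa> = 0 the connection is zero, and if all \<open>p i\<close> vanish it is flat
  and invariant whatever \<mu> is; in both cases condition (2) can fail. Hence the conditions are
  shown to be sufficient in general, and the equivalence is stated for nonzero \<kappa> and nonzero
  \<open>p i\<close>.\<close>

theorem theorem4p2:
  fixes G :: "(complex ^ 'n ^ 'n) set"
    and P :: "'p::finite set"
    and H :: "'p \<Rightarrow> (complex ^ 'n) set"
    and f :: "'p \<Rightarrow> complex ^ 'n \<Rightarrow> complex"
    and \<mu> :: "complex ^ 'n ^ 'n \<Rightarrow> complex"
    and \<kappa> :: complex
    and p :: "'p \<Rightarrow> complex ^ 'p ^ 'p"
    and m :: "'p \<Rightarrow> complex"
    and \<alpha> :: "'p \<Rightarrow> 'p \<Rightarrow> complex"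
  assumes "finite_pseudo_reflection_group G"
    and "indexes_hyperplanes G P H"
    and "\<And>i. i \<in> P \<Longrightarrow> Vector_Spaces.linear (*s) (*) (f i)"
    and "\<And>i. i \<in> P \<Longrightarrow> f i \<noteq> (\<lambda>_. 0)"
    and "\<And>i. i \<in> P \<Longrightarrow> {x. f i x = 0} = H i"
    and "\<And>s t. s \<in> pseudo_reflections G \<Longrightarrow> t \<in> pseudo_reflections G \<Longrightarrow>
           conjugate_in G s t \<Longrightarrow> \<mu> s = \<mu> t"
    and "\<And>i. i \<in> P \<Longrightarrow> p i \<in> End_VG P"
    and "\<And>i. i \<in> P \<Longrightarrow> p i *v bvec i = m i *s bvec i"
    and "\<And>i j. i \<in> P \<Longrightarrow> j \<in> P \<Longrightarrow> j \<noteq> i \<Longrightarrow> p i *v bvec j = \<alpha> i j *s bvec i"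
  defines "\<Omega> \<equiv> LK_connection G P H f \<kappa> \<mu> p"
    and "M \<equiv> hyperplane_complement P H"
    and "conditions \<equiv>
      (\<forall>i\<in>P. \<forall>j\<in>P. (\<exists>w\<in>G. perm_rep P H w *v bvec i = bvec j) \<longrightarrow> m i = m j) \<and>
      (\<forall>i\<in>P. \<forall>j\<in>P. i \<noteq> j \<longrightarrow>
         \<alpha> i j = (\<Sum>s | s \<in> pseudo_reflections G \<and> perm_rep P H s *v bvec j = bvec i. \<mu> s))"
  shows "(conditions \<longrightarrow>
            flat_connection_on M \<Omega> \<and> invariant_connection_on G (perm_rep P H) M \<Omega>) \<and>
         (\<kappa> \<noteq> 0 \<and> (\<forall>i\<in>P. p i \<noteq> 0) \<longrightarrow>
            (flat_connection_on M \<Omega> \<and> invariant_connection_on G (perm_rep P H) M \<Omega> \<longleftrightarrow> conditions))"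
proof -
  interpret LK_connection_data G P H f \<mu> p m \<alpha>
    by (intro LK_connection_data.intro reflection_arrangement.intro LK_connection_data_axioms.intro assms(1-9))
  have \<Omega>: "\<Omega> = log_form P (\<lambda>i. \<kappa> *m X i)"
    unfolding \<Omega>_def by (rule LK_connection_eq)
  have M: "M = regular"
    unfolding M_def by (rule regular_eq[symmetric])
  have c: "conditions = LK_conditions"
    unfolding conditions_def LK_conditions_eq ..
  show ?thesis
    unfolding \<Omega> M c
    using flat_and_invariant_if_conditions conditions_if_flat_and_invariant by blast
qed

end
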